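(* Let $\mathbb{K}$ be a field of characteristic zero, $\lambda$ a positive integer, and $d\in\mathbb{K}[x,y,z]$ an irreducible polynomial such that there is a positive integer $m$ with $\sigma_x^m(d)=\sigma_y^n\sigma_z^k(d)$ for some $n,k\in\mathbb{Z}$; let $m$ be the smallest such positive integer and fix such integers $n,k$. Suppose there are no integers $n_1,k_1$ with $n_1>0$ such that $\sigma_y^{n_1}(d)=\sigma_z^{k_1}(d)$. Let $$r=\frac{1}{d^\lambda}\sum_{i=1}^I\sum_{\ell=1}^{m_i}\frac{b_{i,\ell}}{c_i^\ell},$$ where $b_{i,\ell}\in\mathbb{K}[x,y,z]$ with $\deg_z(b_{i,\ell})<\deg_z(d)$, the $c_i\in\mathbb{K}[x,y]$ are pairwise distinct irreducible polynomials with $\deg_y(b_{i,\ell})<\deg_y(c_i)$, and for every $i$ there is no positive integer $t$ with $\sigma_x^{tm}(c_i)=\sigma_y^{tn}(c_i)$. Then $r$ has a telescoper if and only if $r=0$.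
   Context: $\sigma_x,\sigma_y,\sigma_z$ are the shift automorphisms of $\mathbb{K}(x,y,z)$: $\sigma_x(f)=f(x+1,y,z)$, $\sigma_y(f)=f(x,y+1,z)$, $\sigma_z(f)=f(x,y,z+1)$. A rational function $g\in\mathbb{K}(x,y,z)$ is $(\sigma_y,\sigma_z)$-summable if $g=\sigma_y(u)-u+\sigma_z(v)-v$ for some $u,v\in\mathbb{K}(x,y,z)$. A telescoper for $f$ is a nonzero operator $L=\sum_i \ell_i S_x^i$ with $\ell_i\in\mathbb{K}(x)$ such that $L(f)=\sum_i\ell_i f(x+i,y,z)$ is $(\sigma_y,\sigma_z)$-summable. *)

theory Defs
  imports "HOL-Computational_Algebra.Polynomial" "HOL-Computational_Algebra.Fraction_Field"
begin

text \<open>Representation: K[x] = 'a poly (variable x),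
  K[x,y] = 'a poly poly (outer variable y, coefficients in K[x]),
  K[x,y,z] = 'a poly poly poly (outer variable z, coefficients in K[x,y]).
  Rational function fields are the fraction fields ('a ... fract).\<close>

type_synonym 'a polyx = "'a poly"
type_synonym 'a polyxy = "'a poly poly"
type_synonym 'a polyxyz = "'a poly poly poly"
type_synonym 'a ratx = "'a poly fract"
type_synonym 'a ratxyz = "'a poly poly poly fract"

definition shx2 :: "int \<Rightarrow> 'a::comm_ring_1 polyxy \<Rightarrow> 'a polyxy" where
  "shx2 a q = map_poly (\<lambda>p. pcompose p [:of_int a, 1:]) q"
definition shy2 :: "int \<Rightarrow> 'a::comm_ring_1 polyxy \<Rightarrow> 'a polyxy" where
  "shy2 a q = pcompose q [:[:of_int a:], 1:]"

definition shx3 :: "int \<Rightarrow> 'a::comm_ring_1 polyxyz \<Rightarrow> 'a polyxyz" where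
  "shx3 a p = map_poly (shx2 a) p"
definition shy3 :: "int \<Rightarrow> 'a::comm_ring_1 polyxyz \<Rightarrow> 'a polyxyz" where
  "shy3 a p = map_poly (shy2 a) p"
definition shz3 :: "int \<Rightarrow> 'a::comm_ring_1 polyxyz \<Rightarrow> 'a polyxyz" where
  "shz3 a p = pcompose p [:[:[:of_int a:]:], 1:]"

text \<open>Extending a map on an integral domain to its fraction field, applied to
  numerator and denominator of some representation (well defined for injective ring homs).\<close>
definition fract_map :: "('a::idom \<Rightarrow> 'b::idom) \<Rightarrow> 'a fract \<Rightarrow> 'b fract" where
  "fract_map h f = (let (a, b) = (SOME (a, b). b \<noteq> 0 \<and> f = Fract a b) in Fract (h a) (h b))"

definition sigx :: "int \<Rightarrow> 'a::idom ratxyz \<Rightarrow> 'a ratxyz" where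
  "sigx a = fract_map (shx3 a)"
definition sigy :: "int \<Rightarrow> 'a::idom ratxyz \<Rightarrow> 'a ratxyz" where
  "sigy a = fract_map (shy3 a)"
definition sigz :: "int \<Rightarrow> 'a::idom ratxyz \<Rightarrow> 'a ratxyz" where
  "sigz a = fract_map (shz3 a)"

definition embx :: "'a::idom ratx \<Rightarrow> 'a ratxyz" where
  "embx = fract_map (\<lambda>p. [:[:p:]:])"

definition rat3 :: "'a::idom polyxyz \<Rightarrow> 'a ratxyz" where
  "rat3 p = Fract p 1"

definition yz_summable :: "'a::idom ratxyz \<Rightarrow> bool" where
  "yz_summable g \<longleftrightarrow> (\<exists>u v. g = sigy 1 u - u + sigz 1 v - v)"

definition has_telescoper :: "'a::idom ratxyz \<Rightarrow> bool" where
  "has_telescoper f \<longleftrightarrow> (\<exists>(N::nat) (l::nat \<Rightarrow> 'a ratx).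
      (\<exists>i\<le>N. l i \<noteq> 0) \<and> yz_summable (\<Sum>i\<le>N. embx (l i) * sigx (int i) f))"

definition degz :: "'a::zero polyxyz \<Rightarrow> nat" where
  "degz p = degree p"
definition degy3 :: "'a::zero polyxyz \<Rightarrow> nat" where
  "degy3 p = (MAX j\<in>{..degree p}. degree (coeff p j))"
definition degy2 :: "'a::zero polyxy \<Rightarrow> nat" where
  "degy2 q = degree q"

end

theory Submission
  imports Defs "Berlekamp_Zassenhaus.Unique_Factorization_Poly" "HOL-Library.Product_Plus"
begin

text \<open>
  Write r as a / d^lam with a proper in z over K(x,y), and let i0 be the largest index of
  a nonzero coefficient of a telescoper. The polar parts of a rational function along a free
  orbit of the shifts in y and z, translated back to one point of the orbit and added up, give an
  invariant that vanishes on summable functions. For the orbit of q, the shift of d by i0 in x, only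
  the indices congruent to i0 modulo m contribute, and the invariant says that the sum X of the
  corresponding multiples of shifts of a is regular at q after division by q^lam. As X is proper
  in z, it is 0, so a satisfies a linear recurrence over K(x) for the shift by m, - n, - k.
  The poles of a are among the c_i, and this shift has no finite orbit on them. A last pole in its
  orbit therefore survives in the leading term of the recurrence, so a has no poles;
  being proper in y, it is 0.
\<close>

section \<open>Poles along an orbit\<close>

text \<open>Polar parts are determined only up to functions without a pole, so the invariant lives
  in the additive quotient of K(x,y,z) by the local ring at \<open>q\<close>; regularity at a prime
  therefore replaces explicit partial fractions. The coefficient ring K[x,y] is not a field, and
  Bezout identities hold only up to a nonzero factor free of z. Such factors are harmless, since no
  prime of positive degree in z divides them. Translating a polar part back to \<open>q\<close> is
  unambiguous only if no nontrivial shift in y and z fixes \<open>q\<close>; this is where the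
  hypothesis on \<open>n1\<close> and \<open>k1\<close> enters. Translates that agree up to a unit
  must moreover be equal, which follows from a leading coefficient that all shifts preserve. The
  relation between \<open>m\<close>, \<open>n\<close> and \<open>k\<close> says that the shift by
  \<open>(m, - n, - k)\<close> fixes \<open>d\<close>. Hence terms whose indices differ by multiples
  of \<open>m\<close> can be moved, modulo summable functions, to one common denominator, while
  minimality of \<open>m\<close> keeps all other indices out of that orbit.\<close>

lemma fract_map_Fract:
  assumes "\<And>x y. h (x * y) = h x * h y" and "\<And>x. h x = 0 \<longleftrightarrow> x = 0" and "b \<noteq> 0"
  shows "fract_map h (Fract a b) = Fract (h a) (h b)"
proof -
  define P where "P = (\<lambda>(a', b'). b' \<noteq> 0 \<and> Fract a b = Fract a' b')"
  obtain a' b' where ab: "(SOME z. P z) = (a', b')" by (metis surj_pair)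
  have "P (a, b)" using assms by (simp add: P_def)
  hence "P (a', b')" using ab someI[of P "(a, b)"] by metis
  hence "b' \<noteq> 0" "a * b' = a' * b" using assms(3) by (auto simp: P_def eq_fract)
  moreover from this have "h a * h b' = h a' * h b" using assms(1) by metis
  ultimately have "Fract (h a') (h b') = Fract (h a) (h b)"
    using assms(2,3) by (simp add: eq_fract)
  moreover have "fract_map h (Fract a b) = Fract (h a') (h b')"
    using ab unfolding fract_map_def P_def by simp
  ultimately show ?thesis by simp
qed

text \<open>For a prime \<open>p\<close> this is membership in the localization at the ideal
  generated by \<open>p\<close>: there is no pole at \<open>p\<close>. Asking for some suitable
  representation avoids reduced fractions, which a general domain does not have.\<close>

definition regular_at :: "'r::idom \<Rightarrow> 'r fract \<Rightarrow> bool" where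
  "regular_at p f \<longleftrightarrow> (\<exists>a b. f = Fract a b \<and> \<not> p dvd b)"

lemma regular_atI: "\<not> p dvd b \<Longrightarrow> regular_at p (Fract a b)"
  by (auto simp: regular_at_def)

lemma regular_at_0 [simp]: "prime_elem p \<Longrightarrow> regular_at p 0"
  using regular_atI[of p 1 0] by (simp add: Zero_fract_def prime_elem_not_unit)

lemma regular_at_mult:
  assumes "prime_elem p" "regular_at p f" "regular_at p g"
  shows "regular_at p (f * g)"
proof -
  from assms obtain a b a' b' where "f = Fract a b" "g = Fract a' b'" "\<not> p dvd b" "\<not> p dvd b'"
    by (auto simp: regular_at_def)
  thus ?thesis using assms(1) by (auto intro!: regular_atI simp: prime_elem_dvd_mult_iff)
qed

lemma regular_at_add:
  assumes "prime_elem p" "regular_at p f" "regular_at p g"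
  shows "regular_at p (f + g)"
proof -
  from assms obtain a b a' b' where *: "f = Fract a b" "g = Fract a' b'" "\<not> p dvd b" "\<not> p dvd b'"
    by (auto simp: regular_at_def)
  moreover from this have "b \<noteq> 0" "b' \<noteq> 0" by auto
  ultimately show ?thesis using assms(1)
    by (auto intro!: regular_atI simp: prime_elem_dvd_mult_iff)
qed

lemma regular_at_minus: "regular_at p f \<Longrightarrow> regular_at p (- f)"
  unfolding regular_at_def by (metis minus_fract)

lemma regular_at_diff:
  "prime_elem p \<Longrightarrow> regular_at p f \<Longrightarrow> regular_at p g \<Longrightarrow> regular_at p (f - g)"
  using regular_at_add[of p f "- g"] regular_at_minus[of p g] by simp

lemma regular_at_sum:
  "prime_elem p \<Longrightarrow> (\<And>i. i \<in> A \<Longrightarrow> regular_at p (f i)) \<Longrightarrow> regular_at p (sum f A)"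
  by (induction A rule: infinite_finite_induct) (auto intro: regular_at_add)

text \<open>Each \<open>act g\<close> is an automorphism with inverse \<open>act (- g)\<close>. The
  orbit argument uses nothing else about the shifts, which enter later as an action of the group of
  integer triples.\<close>

locale ring_action =
  fixes act :: "'g::ab_group_add \<Rightarrow> 'r::idom \<Rightarrow> 'r"
  assumes act_add: "act g (p + q) = act g p + act g q"
    and act_mult: "act g (p * q) = act g p * act g q"
    and act_1 [simp]: "act g 1 = 1"
    and act_zero_left [simp]: "act 0 p = p"
    and act_act: "act g (act h p) = act (g + h) p"
begin

lemma act_0 [simp]: "act g 0 = 0"
  using act_add[of g 0 0] by (metis add_cancel_right_right add.right_neutral)

lemma act_uminus_cancel [simp]: "act (- g) (act g p) = p" "act g (act (- g) p) = p"
  by (simp_all add: act_act)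

lemma act_eq_0_iff [simp]: "act g p = 0 \<longleftrightarrow> p = 0"
  by (metis act_0 act_uminus_cancel(1))

lemma act_dvd_iff [simp]: "act g p dvd act g q \<longleftrightarrow> p dvd q"
  unfolding dvd_def by (metis act_mult act_uminus_cancel)

lemma act_dvd_shift: "act g p dvd q \<longleftrightarrow> p dvd act (- g) q"
  by (metis act_dvd_iff act_uminus_cancel(2))

lemma prime_elem_act [simp]: "prime_elem (act g p) \<longleftrightarrow> prime_elem p"
proof -
  have *: "prime_elem (act g p)" if "prime_elem p" for g p
    using that unfolding prime_elem_def
    by (auto simp: act_dvd_shift act_mult)
  from *[of "act g p" "- g"] *[of p g] show ?thesis by auto
qed

definition fract_act :: "'g \<Rightarrow> 'r fract \<Rightarrow> 'r fract" where
  "fract_act g = fract_map (act g)"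

lemma fract_act_Fract: "b \<noteq> 0 \<Longrightarrow> fract_act g (Fract a b) = Fract (act g a) (act g b)"
  unfolding fract_act_def by (rule fract_map_Fract) (auto simp: act_mult)

lemma fract_act_add: "fract_act g (f + f') = fract_act g f + fract_act g f'"
  by (cases f; cases f') (simp add: fract_act_Fract act_add act_mult)

lemma fract_act_mult: "fract_act g (f * f') = fract_act g f * fract_act g f'"
  by (cases f; cases f') (simp add: fract_act_Fract act_mult)

lemma fract_act_0 [simp]: "fract_act g 0 = 0"
  by (simp add: Zero_fract_def fract_act_Fract)

lemma fract_act_1 [simp]: "fract_act g 1 = 1"
  by (simp add: One_fract_def fract_act_Fract)

lemma fract_act_minus: "fract_act g (- f) = - fract_act g f"
  using fract_act_add[of g f "- f"] by (simp add: eq_neg_iff_add_eq_0 add.commute)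

lemma fract_act_diff: "fract_act g (f - f') = fract_act g f - fract_act g f'"
  using fract_act_add[of g f "- f'"] by (simp add: fract_act_minus)

lemma fract_act_sum: "fract_act g (sum F A) = (\<Sum>i\<in>A. fract_act g (F i))"
  by (induction A rule: infinite_finite_induct) (auto simp: fract_act_add)

lemma fract_act_inverse: "fract_act g (inverse f) = inverse (fract_act g f)"
  by (cases "f = 0") (auto simp: fract_act_mult[symmetric] intro!: inverse_unique[symmetric])

lemma fract_act_power: "fract_act g (f ^ k) = fract_act g f ^ k"
  by (induction k) (auto simp: fract_act_mult)

lemma fract_act_zero_left [simp]: "fract_act 0 f = f"
  by (cases f) (simp add: fract_act_Fract)

lemma fract_act_fract_act: "fract_act g (fract_act h f) = fract_act (g + h) f"
  by (cases f) (simp add: fract_act_Fract act_act)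

lemma regular_at_act [simp]: "regular_at (act g p) (fract_act g f) \<longleftrightarrow> regular_at p f"
proof -
  have *: "regular_at (act g p) (fract_act g f)" if reg: "regular_at p f" for g p f
  proof -
    from reg obtain a b where ab: "f = Fract a b" "\<not> p dvd b" by (auto simp: regular_at_def)
    moreover from this have "b \<noteq> 0" by auto
    ultimately show ?thesis by (auto simp: fract_act_Fract intro!: regular_atI)
  qed
  show ?thesis using *[of p f g] *[of "act g p" "fract_act g f" "- g"] by (auto simp: fract_act_fract_act)
qed

lemma regular_at_fract_act_shift: "regular_at p (fract_act g f) \<longleftrightarrow> regular_at (act (- g) p) f"
  using regular_at_act[of g "act (- g) p" f] by simp

text \<open>Summing the polar parts of a function along the orbit of q, after translating all of them
  back to q, gives an invariant that vanishes on differences. If q is the only point of the orbit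
  where f may have a pole, then this invariant is the polar part of f itself.\<close>

lemma regular_at_if_difference:
  assumes H: "0 \<in> H" "\<And>s t. s \<in> H \<Longrightarrow> t \<in> H \<Longrightarrow> s - t \<in> H"
    and q: "prime_elem q"
    and finite_poles: "\<And>f. finite {t \<in> H. \<not> regular_at (act t q) f}"
    and polar_part: "\<And>f. \<exists>g. regular_at q (f - g) \<and> (\<forall>t\<in>H. t \<noteq> 0 \<longrightarrow> regular_at (act t q) g)"
    and h: "h1 \<in> H" "h2 \<in> H"
    and f: "f = fract_act h1 u - u + (fract_act h2 v - v)"
    and reg: "\<And>t. t \<in> H \<Longrightarrow> t \<noteq> 0 \<Longrightarrow> regular_at (act t q) f"
  shows "regular_at q f"
proof -
  have Hadd: "s + t \<in> H" if "s \<in> H" "t \<in> H" for s t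
    using H(2)[OF that(1) H(2)[OF H(1) that(2)]] by simp
  \<comment> \<open>Along the orbit, \<open>F s\<close> may have a pole only at
    \<open>act s q\<close>, and together the \<open>F s\<close> account for all poles of
    \<open>f\<close> there. \<open>T\<close> may exceed the support of \<open>F\<close>, so that two
    decompositions can be put over one index set.\<close>
  define polar where "polar = (\<lambda>f T F. finite T \<and> T \<subseteq> H \<and> (\<forall>s. s \<notin> T \<longrightarrow> F s = 0) \<and>
      (\<forall>s\<in>H. \<forall>t\<in>H. s \<noteq> t \<longrightarrow> regular_at (act t q) (F s)) \<and>
      (\<forall>t\<in>H. regular_at (act t q) (f - sum F T)))"
  have ex_polar: "\<exists>T F. polar f T F" for f
  proof -
    define T where "T = {t \<in> H. \<not> regular_at (act t q) f}"
    have "\<exists>g. regular_at (act s q) (f - g) \<and> (\<forall>t\<in>H. t \<noteq> s \<longrightarrow> regular_at (act t q) g)"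
      if s: "s \<in> H" for s
    proof -
      obtain g where g: "regular_at q (fract_act (- s) f - g)"
        "\<And>t. t \<in> H \<Longrightarrow> t \<noteq> 0 \<Longrightarrow> regular_at (act t q) g"
        using polar_part by blast
      have "regular_at (act s q) (f - fract_act s g)"
        using g(1) regular_at_act[of s q "fract_act (- s) f - g"] by (simp add: fract_act_diff fract_act_fract_act)
      moreover have "regular_at (act t q) (fract_act s g)" if "t \<in> H" "t \<noteq> s" for t
        using g(2)[of "t - s"] H(2) s that by (simp add: regular_at_fract_act_shift act_act)
      ultimately show ?thesis by blast
    qed
    then obtain F where F: "\<And>s. s \<in> H \<Longrightarrow> regular_at (act s q) (f - F s)"
      "\<And>s t. s \<in> H \<Longrightarrow> t \<in> H \<Longrightarrow> t \<noteq> s \<Longrightarrow> regular_at (act t q) (F s)"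
      by metis
    \<comment> \<open>The functions chosen at points without a pole are arbitrary regular ones; they
      are cut off to make the support finite.\<close>
    define F' where "F' = (\<lambda>s. if s \<in> T then F s else 0)"
    have fin: "finite T" using finite_poles by (simp add: T_def)
    have sub: "T \<subseteq> H" by (auto simp: T_def)
    have eq: "sum F' T = sum F T" by (simp add: F'_def)
    have "regular_at (act t q) (f - sum F T)" if t: "t \<in> H" for t
    proof -
      have q': "prime_elem (act t q)" using q by simp
      have regF: "regular_at (act t q) (F i)" if "i \<in> T" "i \<noteq> t" for i
        using F(2)[of i t] sub t that by blast
      show ?thesis
      proof (cases "t \<in> T")
        case True
        have "f - sum F T = (f - F t) - sum F (T - {t})"
          using True fin by (simp add: sum.remove)
        moreover have "regular_at (act t q) (sum F (T - {t}))"
          using regF by (intro regular_at_sum[OF q']) auto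
        ultimately show ?thesis using regular_at_diff[OF q' F(1)[OF t]] by metis
      next
        case False
        have "regular_at (act t q) (sum F T)"
          using regF False by (intro regular_at_sum[OF q']) auto
        moreover have "regular_at (act t q) f" using t False by (auto simp: T_def)
        ultimately show ?thesis using regular_at_diff[OF q'] by blast
      qed
    qed
    hence "polar f T F'" unfolding polar_def eq using fin sub F q
      by (auto simp: F'_def)
    thus ?thesis by blast
  qed
  \<comment> \<open>The invariant is zero only modulo functions regular at \<open>q\<close>. Asking
    for one decomposition whose translated parts cancel exactly avoids forming that
    quotient.\<close>
  define balanced where
    "balanced = (\<lambda>f. \<exists>T F. polar f T F \<and> (\<Sum>s\<in>T. fract_act (- s) (F s)) = 0)"
  have polar_mono: "polar f T' F" "(\<Sum>s\<in>T'. fract_act (- s) (F s)) = (\<Sum>s\<in>T. fract_act (- s) (F s))"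
    if "polar f T F" "T \<subseteq> T'" "finite T'" "T' \<subseteq> H" for f T T' F
  proof -
    have "sum F T' = sum F T" using that
      by (intro sum.mono_neutral_right) (auto simp: polar_def)
    thus "polar f T' F" using that by (auto simp: polar_def)
    show "(\<Sum>s\<in>T'. fract_act (- s) (F s)) = (\<Sum>s\<in>T. fract_act (- s) (F s))" using that
      by (intro sum.mono_neutral_right) (auto simp: polar_def)
  qed
  have balanced_add: "balanced (f + g)" if fg: "balanced f" "balanced g" for f g
  proof -
    obtain T F where F: "polar f T F" "(\<Sum>s\<in>T. fract_act (- s) (F s)) = 0"
      using fg by (auto simp: balanced_def)
    obtain T' G where G: "polar g T' G" "(\<Sum>s\<in>T'. fract_act (- s) (G s)) = 0"
      using fg by (auto simp: balanced_def)
    have U: "T \<subseteq> T \<union> T'" "T' \<subseteq> T \<union> T'" "finite (T \<union> T')" "T \<union> T' \<subseteq> H"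
      using F(1) G(1) by (auto simp: polar_def)
    note F' = polar_mono[OF F(1) U(1,3,4)] and G' = polar_mono[OF G(1) U(2,3,4)]
    have "regular_at (act t q) (f + g - (\<Sum>s\<in>T \<union> T'. F s + G s))" if "t \<in> H" for t
    proof -
      have "f + g - (\<Sum>s\<in>T \<union> T'. F s + G s)
            = (f - sum F (T \<union> T')) + (g - sum G (T \<union> T'))"
        by (simp add: sum.distrib algebra_simps)
      also have "regular_at (act t q) \<dots>"
        using F'(1) G'(1) that q by (intro regular_at_add) (simp_all add: polar_def)
      finally show ?thesis .
    qed
    hence "polar (f + g) (T \<union> T') (\<lambda>s. F s + G s)"
      using F'(1) G'(1) q unfolding polar_def by (auto intro!: regular_at_add)
    moreover have "(\<Sum>s\<in>T \<union> T'. fract_act (- s) (F s + G s)) = 0"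
      using F(2) G(2) F'(2) G'(2) by (simp add: fract_act_add sum.distrib)
    ultimately show ?thesis unfolding balanced_def by blast
  qed
  have balanced_diff: "balanced (fract_act h u - u)" if h: "h \<in> H" for h u
  proof -
    obtain T F where F: "polar u T F" using ex_polar by blast
    \<comment> \<open>The poles of \<open>fract_act h u\<close> sit at the positions of those of
      \<open>u\<close> moved by \<open>h\<close>; both sets of positions are needed.\<close>
    define U where "U = T \<union> (\<lambda>s. h + s) ` T"
    have U: "T \<subseteq> U" "finite U" "U \<subseteq> H" and TH: "T \<subseteq> H" "finite T"
      using F h Hadd by (auto simp: U_def polar_def)
    have F0: "F s = 0" if "s \<notin> T" for s using F that by (auto simp: polar_def)
    have shift: "(\<Sum>s\<in>U. \<phi> (s - h)) = (\<Sum>s\<in>T. \<phi> s)" if \<phi>: "\<And>s. s \<notin> T \<Longrightarrow> \<phi> s = (0::'r fract)" for \<phi>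
    proof -
      have "(\<Sum>s\<in>U. \<phi> (s - h)) = (\<Sum>s\<in>(\<lambda>s. h + s) ` T. \<phi> (s - h))"
      proof (rule sum.mono_neutral_right)
        show "\<forall>i\<in>U - (+) h ` T. \<phi> (i - h) = 0"
        proof
          fix i assume "i \<in> U - (+) h ` T"
          hence "i - h \<notin> T" by (metis DiffD2 add.commute diff_add_cancel imageI)
          thus "\<phi> (i - h) = 0" by (rule \<phi>)
        qed
      qed (use U in \<open>auto simp: U_def\<close>)
      also have "\<dots> = (\<Sum>s\<in>T. \<phi> s)" by (subst sum.reindex) auto
      finally show ?thesis .
    qed
    \<comment> \<open>Translated back by \<open>- s\<close>, the first summand becomes the part of
      \<open>u\<close> at \<open>s - h\<close> translated back by \<open>- (s - h)\<close>. After
      reindexing, the two sums over \<open>U\<close> cancel.\<close>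
    define G where "G = (\<lambda>s. fract_act h (F (s - h)) - F s)"
    note F' = polar_mono[OF F U]
    have sumG: "sum G U = fract_act h (sum F T) - sum F T"
    proof -
      have "sum F U = sum F T" using U F0 by (intro sum.mono_neutral_right) auto
      thus ?thesis using shift[of "\<lambda>s. fract_act h (F s)"] F0
        by (simp add: G_def sum_subtractf fract_act_sum)
    qed
    have 1: "regular_at (act t q) (fract_act h u - u - sum G U)" if "t \<in> H" for t
    proof -
      have "fract_act h u - u - sum G U = fract_act h (u - sum F T) - (u - sum F T)"
        unfolding sumG by (simp add: fract_act_diff)
      moreover have "regular_at (act t q) (fract_act h (u - sum F T))"
        using F that h H(2) by (auto simp: regular_at_fract_act_shift act_act polar_def)
      moreover have "regular_at (act t q) (u - sum F T)"
        using F that by (auto simp: polar_def)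
      moreover have "prime_elem (act t q)" using q by simp
      ultimately show ?thesis by (metis regular_at_diff)
    qed
    have 2: "regular_at (act t q) (G s)" if "s \<in> H" "t \<in> H" "s \<noteq> t" for s t
    proof -
      have "regular_at (act (t - h) q) (F (s - h))"
        using F that h H(2) by (auto simp: polar_def)
      moreover have "regular_at (act t q) (F s)" using F that by (auto simp: polar_def)
      ultimately show ?thesis using q
        by (auto simp: G_def regular_at_fract_act_shift act_act intro!: regular_at_diff)
    qed
    have "G s = 0" if "s \<notin> U" for s
    proof -
      have "s - h \<notin> T" using that unfolding U_def
        by (metis UnCI add.commute diff_add_cancel imageI)
      moreover have "s \<notin> T" using that U by auto
      ultimately show ?thesis by (simp add: G_def F0)
    qed
    hence "polar (fract_act h u - u) U G" using 1 2 U unfolding polar_def by blast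
    moreover have "(\<Sum>s\<in>U. fract_act (- s) (G s)) = 0"
    proof -
      have "(\<Sum>s\<in>U. fract_act (- s) (G s)) =
        (\<Sum>s\<in>U. fract_act (- (s - h)) (F (s - h))) - (\<Sum>s\<in>U. fract_act (- s) (F s))"
        by (simp add: G_def fract_act_diff sum_subtractf fract_act_fract_act)
      also have "\<dots> = 0" using shift[of "\<lambda>s. fract_act (- s) (F s)"] F'(2) F0 by simp
      finally show ?thesis .
    qed
    ultimately show ?thesis unfolding balanced_def by blast
  qed
  have "balanced f" unfolding f using balanced_add balanced_diff h by blast
  then obtain T0 F where F0: "polar f T0 F" "(\<Sum>s\<in>T0. fract_act (- s) (F s)) = 0"
    by (auto simp: balanced_def)
  \<comment> \<open>The point \<open>q\<close> itself is made a member of the index set, so that its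
    part can be split off.\<close>
  define T where "T = insert 0 T0"
  have T: "T0 \<subseteq> T" "finite T" "T \<subseteq> H" "0 \<in> T" using F0(1) H(1) by (auto simp: T_def polar_def)
  note F = polar_mono[OF F0(1) T(1-3)]
  have regF: "regular_at (act t q) (F s)" if "s \<in> H" "t \<in> H" "s \<noteq> t" for s t
    using F(1) that by (auto simp: polar_def)
  have regf: "regular_at (act t q) (f - sum F T)" if "t \<in> H" for t
    using F(1) that by (auto simp: polar_def)
  \<comment> \<open>Where \<open>f\<close> has no pole, its polar part has none either. Balance then
    expresses \<open>F 0\<close> through parts that are regular at \<open>q\<close> after
    translation.\<close>
  have "regular_at q (fract_act (- t) (F t))" if t: "t \<in> T" "t \<noteq> 0" for t
  proof -
    have "F t = f - (f - sum F T) - sum F (T - {t})"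
      using T t by (simp add: sum.remove[of T t])
    moreover have "regular_at (act t q) (sum F (T - {t}))"
      using T t q by (intro regular_at_sum regF) auto
    moreover have "regular_at (act t q) (f - (f - sum F T))"
      using regular_at_diff[OF _ reg[of t] regf[of t]] T t q by auto
    moreover have "prime_elem (act t q)" using q by simp
    ultimately have "regular_at (act t q) (F t)" by (metis regular_at_diff)
    thus ?thesis by (simp add: regular_at_fract_act_shift)
  qed
  hence "regular_at q (- (\<Sum>t\<in>T - {0}. fract_act (- t) (F t)))"
    using q by (intro regular_at_minus regular_at_sum) auto
  moreover have "F 0 = - (\<Sum>t\<in>T - {0}. fract_act (- t) (F t))"
    using F(2) F0(2) T by (simp add: sum.remove[of T 0] eq_neg_iff_add_eq_0)
  ultimately have "regular_at q (F 0)" by simp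
  moreover have "regular_at q (sum F (T - {0}))"
    using q T regF[of _ 0] H(1) by (intro regular_at_sum) (auto simp: subset_iff)
  moreover have "regular_at q (f - sum F T)" using regf[of 0] H(1) by simp
  moreover have "f = (f - sum F T) + (F 0 + sum F (T - {0}))"
    using T by (simp add: sum.remove[of T 0])
  ultimately show ?thesis using q by (metis regular_at_add)
qed

end

section \<open>Primes in polynomial rings\<close>

text \<open>By pseudo-division, a nonzero combination \<open>h\<close> of least degree divides
  nonzero constant multiples of both \<open>p\<close> and \<open>q\<close>. Since \<open>p\<close>
  is prime of positive degree and does not divide \<open>q\<close>, it does not divide
  \<open>h\<close>; in \<open>smult a p = h * s\<close> it can therefore be cancelled against
  \<open>s\<close>, which leaves \<open>h\<close> constant.\<close>

lemma bezout_const_poly: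
  fixes p q :: "'b::idom poly"
  assumes p: "prime_elem p" "degree p > 0" "\<not> p dvd q"
  shows "\<exists>u v c. c \<noteq> 0 \<and> u * p + v * q = [:c:]"
proof -
  define J where "J = {h. h \<noteq> 0 \<and> (\<exists>u v. h = u * p + v * q)}"
  have "p = 1 * p + 0 * q" by simp
  moreover have "p \<noteq> 0" using p(2) by auto
  ultimately have "p \<in> J" unfolding J_def by blast
  then obtain h where h: "h \<in> J" "\<And>h'. h' \<in> J \<Longrightarrow> degree h \<le> degree h'"
    using ex_has_least_nat[of "\<lambda>h. h \<in> J" p degree] by blast
  then obtain u v where uv: "h \<noteq> 0" "h = u * p + v * q" by (auto simp: J_def)
  have div: "\<exists>a s. a \<noteq> 0 \<and> smult a f = h * s" if f: "f = u' * p + v' * q" for f u' v'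
  proof -
    obtain a s where as: "a \<noteq> 0" "smult a f = h * s + pseudo_mod f h"
      using pseudo_mod(1)[OF uv(1), of f] by blast
    have "pseudo_mod f h = smult a f - h * s" using as by simp
    also have "\<dots> = ([:a:] * u' - s * u) * p + ([:a:] * v' - s * v) * q"
      by (subst uv(2)) (simp add: f algebra_simps smult_add_right)
    finally have "pseudo_mod f h = 0"
      using h(2)[of "pseudo_mod f h"] pseudo_mod(2)[OF uv(1), of f] unfolding J_def by fastforce
    thus ?thesis using as by auto
  qed
  obtain a s where as: "a \<noteq> 0" "smult a p = h * s" using div[of p 1 0] by auto
  obtain a' s' where as': "a' \<noteq> 0" "smult a' q = h * s'" using div[of q 0 1] by auto
  have "\<not> p dvd h"
  proof
    assume "p dvd h"
    hence "p dvd [:a':] * q" using as' by simp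
    hence "p dvd [:a':]" using p(3) prime_elem_dvd_mult_iff[OF p(1)] by blast
    thus False using p(2) as'(1) by (auto dest: dvd_imp_degree_le)
  qed
  moreover have "p dvd h * s" unfolding as(2)[symmetric] by (simp add: dvd_smult)
  ultimately have "p dvd s" using p by (simp add: prime_elem_dvd_mult_iff)
  then obtain s2 where "s = p * s2" by (auto simp: dvd_def)
  hence "p * [:a:] = p * (h * s2)" using as(2) by (simp add: algebra_simps)
  hence "[:a:] = h * s2" using p(2) by (subst (asm) mult_left_cancel) auto
  hence "degree h = 0" using as(1)
    by (metis degree_mult_eq degree_pCons_0 add_is_0 mult_zero_right pCons_eq_0_iff uv(1))
  then obtain c where c: "h = [:c:]" by (rule degree_eq_zeroE)
  hence "c \<noteq> 0" using uv(1) by simp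
  moreover have "u * p + v * q = [:c:]" using uv(2) c by simp
  ultimately show ?thesis by blast
qed

text \<open>\<open>[:c:] - u * p\<close>, which is a multiple of \<open>q\<close>, divides
  \<open>[:c:] ^ e - (u * p) ^ e\<close>; the new constant is \<open>c ^ e\<close>.\<close>

lemma bezout_const_poly_power:
  fixes p q :: "'b::idom poly"
  assumes p: "prime_elem p" "degree p > 0" "\<not> p dvd q"
  shows "\<exists>u v c. c \<noteq> 0 \<and> u * p ^ e + v * q = [:c:]"
proof -
  obtain u v c where c: "c \<noteq> 0" "u * p + v * q = [:c:]"
    using bezout_const_poly[OF p] by blast
  have "([:c:] - u * p) dvd ([:c:] ^ e - (u * p) ^ e)"
    by (simp add: power_diff_sumr2)
  moreover have "[:c:] - u * p = v * q" using c(2) by (simp add: algebra_simps)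
  ultimately obtain w where "[:c:] ^ e - (u * p) ^ e = v * q * w" unfolding dvd_def by metis
  hence "u ^ e * p ^ e + (v * w) * q = [:c ^ e:]"
    by (simp add: algebra_simps power_mult_distrib poly_const_pow)
  thus ?thesis using c(1) by (metis power_not_zero)
qed

lemma poly_split_power:
  fixes p b :: "'b::idom poly"
  assumes "degree p > 0" "b \<noteq> 0"
  shows "\<exists>e b'. b = p ^ e * b' \<and> \<not> p dvd b'"
  using assms(2)
proof (induction "degree b" arbitrary: b rule: less_induct)
  case less
  show ?case
  proof (cases "p dvd b")
    case True
    then obtain b1 where b1: "b = p * b1" by (auto simp: dvd_def)
    hence "b1 \<noteq> 0" "degree b1 < degree b" using less.prems assms(1)
      by (auto simp: degree_mult_eq)
    then obtain e b' where "b1 = p ^ e * b'" "\<not> p dvd b'" using less.hyps by blast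
    thus ?thesis using b1 by (intro exI[of _ "Suc e"] exI[of _ b']) (simp add: mult.assoc)
  next
    case False
    thus ?thesis by (intro exI[of _ 0] exI[of _ b]) simp
  qed
qed

lemma prod_primes_dvd:
  fixes p :: "'i \<Rightarrow> 'r::idom"
  assumes "finite T" "\<And>t. t \<in> T \<Longrightarrow> prime_elem (p t)"
    "\<And>s t. s \<in> T \<Longrightarrow> t \<in> T \<Longrightarrow> s \<noteq> t \<Longrightarrow> \<not> p s dvd p t"
    "\<And>t. t \<in> T \<Longrightarrow> p t dvd b"
  shows "prod p T dvd b"
  using assms
proof (induction T arbitrary: b rule: finite_induct)
  case (insert x T)
  obtain b1 where b1: "b = p x * b1" using insert.prems(3)[of x] by (auto simp: dvd_def)
  have "p t dvd b1" if "t \<in> T" for t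
  proof -
    have "t \<noteq> x" using insert.hyps(2) that by auto
    hence "\<not> p t dvd p x" using insert.prems(2)[of t x] that by simp
    moreover have "p t dvd p x * b1" using insert.prems(3)[of t] that b1 by simp
    ultimately show ?thesis using insert.prems(1)[of t] that by (simp add: prime_elem_dvd_mult_iff)
  qed
  hence "prod p T dvd b1" using insert by auto
  thus ?case using insert.hyps by (simp add: b1 mult_dvd_mono)
qed auto

text \<open>The product of any finitely many of these primes divides \<open>b\<close>, and each
  contributes at least 1 to the degree, so \<open>degree b\<close> bounds their number. Applied to
  an orbit, it shows that a function has a pole at only finitely many of its points.\<close>

lemma finite_prime_divisors_poly:
  fixes p :: "'i \<Rightarrow> 'b::idom poly"
  assumes b: "b \<noteq> 0"
    and p: "\<And>t. t \<in> T \<Longrightarrow> prime_elem (p t)" "\<And>t. t \<in> T \<Longrightarrow> degree (p t) > 0"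
      "\<And>s t. s \<in> T \<Longrightarrow> t \<in> T \<Longrightarrow> s \<noteq> t \<Longrightarrow> \<not> p s dvd p t"
      "\<And>t. t \<in> T \<Longrightarrow> p t dvd b"
  shows "finite T"
proof -
  have "card G \<le> degree b" if G: "G \<subseteq> T" "finite G" for G
  proof -
    have "prod p G dvd b"
      by (rule prod_primes_dvd[OF G(2)]) (simp_all add: p subsetD[OF G(1)])
    hence "degree (prod p G) \<le> degree b" using b by (rule dvd_imp_degree_le)
    moreover have "degree (prod p G) = (\<Sum>t\<in>G. degree (p t))"
      using p(2) G by (intro degree_prod_eq_sum_degree) force
    moreover have "(\<Sum>t\<in>G. 1) \<le> (\<Sum>t\<in>G. degree (p t))"
      using p(2) G by (intro sum_mono) (auto simp: Suc_le_eq)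
    ultimately show ?thesis by simp
  qed
  thus ?thesis using finite_if_finite_subsets_card_bdd by blast
qed

section \<open>Shifts of polynomials\<close>

abbreviation shx1 :: "int \<Rightarrow> 'a::comm_ring_1 poly \<Rightarrow> 'a poly" where
  "shx1 a p \<equiv> pcompose p [:of_int a, 1:]"

lemma map_poly_const: "h 0 = 0 \<Longrightarrow> map_poly h [:c:] = [:h c:]"
  by (simp add: poly_eq_iff coeff_map_poly coeff_pCons split: nat.splits)

lemma pcompose_shift_shift:
  "pcompose (pcompose p (pCons s 1)) (pCons t 1) = pcompose p (pCons (s + t) 1)"
    for p :: "'b::comm_ring_1 poly"
  by (simp add: pcompose_assoc[symmetric] pcompose_pCons pcompose_1)

lemma comm_ring_hom_shx2: "comm_ring_hom (shx2 a)"
proof -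
  interpret map_poly_comm_ring_hom "shx1 a :: 'a::comm_ring_1 poly \<Rightarrow> _" ..
  have "shx2 a = map_poly (shx1 a :: 'a poly \<Rightarrow> _)" by (auto simp: shx2_def)
  thus ?thesis using comm_ring_hom_axioms by simp
qed

lemma comm_ring_hom_shy2: "comm_ring_hom (shy2 a)"
proof -
  have "shy2 a = (\<lambda>q. pcompose q [:[:of_int a :: 'a :: comm_ring_1:], 1:])"
    by (auto simp: shy2_def)
  thus ?thesis using pcompose_hom.comm_ring_hom_axioms by metis
qed

lemma comm_ring_hom_map_poly: "comm_ring_hom h \<Longrightarrow> comm_ring_hom (map_poly h)"
proof -
  assume "comm_ring_hom h"
  then interpret map_poly_comm_ring_hom h by (simp add: map_poly_comm_ring_hom_def)
  show ?thesis by (rule comm_ring_hom_axioms)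
qed

lemma comm_ring_hom_shx3: "comm_ring_hom (shx3 a)"
  using comm_ring_hom_map_poly[OF comm_ring_hom_shx2] by (simp add: shx3_def[abs_def])

lemma comm_ring_hom_shy3: "comm_ring_hom (shy3 a)"
  using comm_ring_hom_map_poly[OF comm_ring_hom_shy2] by (simp add: shy3_def[abs_def])

lemma comm_ring_hom_shz3: "comm_ring_hom (shz3 a)"
  using pcompose_hom.comm_ring_hom_axioms by (simp add: shz3_def[abs_def])

interpretation shx2: comm_ring_hom "shx2 a" by (rule comm_ring_hom_shx2)
interpretation shy2: comm_ring_hom "shy2 a" by (rule comm_ring_hom_shy2)
interpretation shx3: comm_ring_hom "shx3 a" by (rule comm_ring_hom_shx3)
interpretation shy3: comm_ring_hom "shy3 a" by (rule comm_ring_hom_shy3)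
interpretation shz3: comm_ring_hom "shz3 a" by (rule comm_ring_hom_shz3)

lemma shx2_shx2: "shx2 a (shx2 b q) = shx2 (a + b) q"
  unfolding shx2_def by (simp add: map_poly_map_poly o_def pcompose_shift_shift add.commute)

lemma shy2_shy2: "shy2 a (shy2 b q) = shy2 (a + b) q"
  unfolding shy2_def by (simp add: pcompose_shift_shift add.commute)

lemma shx2_shy2: "shx2 a (shy2 b q) = shy2 b (shx2 a q)"
  unfolding shx2_def shy2_def by (simp add: pcompose_hom.map_poly_pcompose pcompose_1)

lemma shx3_shx3: "shx3 a (shx3 b p) = shx3 (a + b) p"
  unfolding shx3_def by (simp add: map_poly_map_poly o_def shx2_shx2)

lemma shy3_shy3: "shy3 a (shy3 b p) = shy3 (a + b) p"
  unfolding shy3_def by (simp add: map_poly_map_poly o_def shy2_shy2)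

lemma shz3_shz3: "shz3 a (shz3 b p) = shz3 (a + b) p"
  unfolding shz3_def by (simp add: pcompose_shift_shift add.commute)

lemma shx3_shy3: "shx3 a (shy3 b p) = shy3 b (shx3 a p)"
  unfolding shx3_def shy3_def by (simp add: map_poly_map_poly o_def shx2_shy2)

lemma shx3_shz3: "shx3 a (shz3 b p) = shz3 b (shx3 a p)"
  unfolding shx3_def shz3_def
  by (simp add: shx2.map_poly_pcompose) (simp add: shx2_def map_poly_const)

lemma shy3_shz3: "shy3 a (shz3 b p) = shz3 b (shy3 a p)"
  unfolding shy3_def shz3_def
  by (simp add: shy2.map_poly_pcompose) (simp add: shy2_def)

lemma pcompose_pCons_0_1 [simp]: "pcompose p (pCons 0 1) = p" for p :: "'b::comm_ring_1 poly"
  using pcompose_idR[of p] by (simp del: pcompose_idR)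

lemma shx2_0 [simp]: "shx2 0 q = q"
  and shy2_0 [simp]: "shy2 0 q = q"
  by (simp_all add: shx2_def shy2_def)

lemma shx3_0 [simp]: "shx3 0 p = p"
  and shy3_0 [simp]: "shy3 0 p = p"
  and shz3_0 [simp]: "shz3 0 p = p"
  by (simp_all add: shx3_def shy3_def shz3_def map_poly_idI)

text \<open>The three commuting shifts become one group action, so that composing mixed shifts is
  addition of triples.\<close>

definition shift3 :: "int \<times> int \<times> int \<Rightarrow> 'a::comm_ring_1 polyxyz \<Rightarrow> 'a polyxyz" where
  "shift3 = (\<lambda>(a, b, c) p. shx3 a (shy3 b (shz3 c p)))"

lemma shift3_const: "shift3 (a, b, e) [:c:] = [:shx2 a (shy2 b c):]"
  by (simp add: shift3_def shx3_def shy3_def shz3_def map_poly_const)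

lemma shift3_const_const: "shift3 (0, b, e) [:[:p:]:] = [:[:p:]:]"
  unfolding shift3_const by (simp add: shy2_def)

text \<open>This is the leading coefficient for the lexicographic order with z above y above x. A
  shift changes only lower terms, so it serves to tell a polynomial from its scalar multiples along
  an orbit.\<close>

definition lead_coeff3 :: "'a::zero polyxyz \<Rightarrow> 'a" where
  "lead_coeff3 p = lead_coeff (lead_coeff (lead_coeff p))"

lemma degree_lead_coeff_pcompose_shift:
  fixes p :: "'b::idom poly"
  shows "degree (pcompose p [:s, 1:]) = degree p" "lead_coeff (pcompose p [:s, 1:]) = lead_coeff p"
  using lead_coeff_comp[of "[:s, 1:]" p] by (simp_all add: degree_pcompose)

lemma degree_lead_coeff_map_poly:
  assumes "comm_ring_hom h" "\<And>x. h x = 0 \<Longrightarrow> x = 0"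
  shows "degree (map_poly h p) = degree p" "lead_coeff (map_poly h p) = h (lead_coeff p)"
proof -
  interpret comm_ring_hom h by fact
  show "degree (map_poly h p) = degree p"
    by (rule degree_map_poly) (use assms(2)[of "lead_coeff p"] in auto)
  thus "lead_coeff (map_poly h p) = h (lead_coeff p)" by (simp add: coeff_map_poly)
qed

lemma shx2_eq_0: "shx2 a q = 0 \<Longrightarrow> q = 0"
  using shx2_shx2[of "- a" a q] by simp

lemma shy2_eq_0: "shy2 a q = 0 \<Longrightarrow> q = 0"
  using shy2_shy2[of "- a" a q] by simp

lemma degree_shift2:
  fixes q :: "'a::idom polyxy"
  shows "degree (shx2 a q) = degree q" "degree (shy2 a q) = degree q"
proof -
  have "comm_ring_hom (shx1 a :: 'a poly \<Rightarrow> _)" by (rule pcompose_hom.comm_ring_hom_axioms)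
  thus "degree (shx2 a q) = degree q" unfolding shx2_def
    by (rule degree_lead_coeff_map_poly) (simp add: pcompose_eq_0_iff)
  show "degree (shy2 a q) = degree q" unfolding shy2_def
    by (rule degree_lead_coeff_pcompose_shift)
qed

lemma lead_coeff_shift2:
  fixes q :: "'a::idom polyxy"
  shows "lead_coeff (shx2 a q) = shx1 a (lead_coeff q)" "lead_coeff (shy2 a q) = lead_coeff q"
proof -
  have "comm_ring_hom (shx1 a :: 'a poly \<Rightarrow> _)" by (rule pcompose_hom.comm_ring_hom_axioms)
  thus "lead_coeff (shx2 a q) = shx1 a (lead_coeff q)" unfolding shx2_def
    by (rule degree_lead_coeff_map_poly) (simp add: pcompose_eq_0_iff)
  show "lead_coeff (shy2 a q) = lead_coeff q" unfolding shy2_def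
    by (rule degree_lead_coeff_pcompose_shift)
qed

lemma degree_shift3 [simp]: "degree (shift3 g p) = degree p" for p :: "'a::idom polyxyz"
  unfolding shift3_def shx3_def shy3_def shz3_def
  by (simp split: prod.split add: degree_lead_coeff_pcompose_shift
      degree_lead_coeff_map_poly[OF comm_ring_hom_shx2 shx2_eq_0]
      degree_lead_coeff_map_poly[OF comm_ring_hom_shy2 shy2_eq_0])

lemma lead_coeff3_shift3 [simp]: "lead_coeff3 (shift3 g p) = lead_coeff3 p" for p :: "'a::idom polyxyz"
proof -
  obtain a b c where g: "g = (a, b, c)" by (cases g)
  have x: "lead_coeff (shx3 a p) = shx2 a (lead_coeff p)" for p :: "'a polyxyz"
    unfolding shx3_def by (rule degree_lead_coeff_map_poly[OF comm_ring_hom_shx2 shx2_eq_0])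
  have y: "lead_coeff (shy3 b p) = shy2 b (lead_coeff p)" for p :: "'a polyxyz"
    unfolding shy3_def by (rule degree_lead_coeff_map_poly[OF comm_ring_hom_shy2 shy2_eq_0])
  have z: "lead_coeff (shz3 c p) = lead_coeff p"
    unfolding shz3_def by (rule degree_lead_coeff_pcompose_shift)
  have "lead_coeff (shift3 g p) = shx2 a (shy2 b (lead_coeff p))"
    unfolding g shift3_def prod.case x y z ..
  hence "lead_coeff3 (shift3 g p) = lead_coeff (lead_coeff (shx2 a (shy2 b (lead_coeff p))))"
    unfolding lead_coeff3_def by metis
  also have "\<dots> = lead_coeff (shx1 a (lead_coeff (lead_coeff p)))"
    by (rule arg_cong[of _ _ lead_coeff])
      (simp only: lead_coeff_shift2(1)[of a "shy2 b (lead_coeff p)"] lead_coeff_shift2(2)[of b "lead_coeff p"])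
  also have "\<dots> = lead_coeff3 p"
    unfolding lead_coeff3_def by (rule degree_lead_coeff_pcompose_shift)
  finally show ?thesis .
qed

text \<open>The quotient of two primes, one dividing the other, is a unit, hence a constant of the
  field, and comparing leading coefficients makes it 1.\<close>

lemma dvd_imp_eq_if_lead_coeff3_eq:
  fixes p p' :: "'a::field polyxyz"
  assumes "prime_elem p" "prime_elem p'" "p dvd p'" "lead_coeff3 p = lead_coeff3 p'"
  shows "p = p'"
proof -
  obtain u where u: "p' = p * u" using assms(3) by (auto simp: dvd_def)
  have "\<not> p dvd 1" using assms(1) by (rule prime_elem_not_unit)
  moreover have "irreducible p'" using assms(2) by simp
  ultimately have "u dvd 1" using u by (metis irreducibleD)
  then obtain k' where "u = [:[:k':]:]" "degree k' = 0" by (auto simp: is_unit_poly_iff)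
  then obtain k where k: "u = [:[:[:k:]:]:]" by (metis degree_eq_zeroE)
  have "p' \<noteq> 0" using assms(2) by (rule prime_elem_not_zeroI)
  hence "lead_coeff3 p' \<noteq> 0" by (simp add: lead_coeff3_def)
  moreover have "lead_coeff3 p' = lead_coeff3 p * k"
    unfolding u lead_coeff3_def lead_coeff_mult by (simp add: k)
  ultimately have "k = 1" using assms(4) by (metis mult_cancel_left1)
  hence "u = 1" using k by simp
  thus ?thesis using u by simp
qed

text \<open>Such a polynomial takes the same value at all points z = i * c, which are infinitely
  many distinct ones in characteristic zero; it is therefore constant in z.\<close>

lemma shz3_eq_self_imp_degree_0:
  fixes p :: "'a::field_char_0 polyxyz"
  assumes "shz3 c p = p" "c \<noteq> 0"
  shows "degree p = 0"
proof -
  define e :: "int \<Rightarrow> 'a polyxy" where "e j = [:[:of_int j:]:]" for j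
  have step: "poly p (e (j + c)) = poly p (e j)" for j
  proof -
    have "poly p (e j) = poly (shz3 c p) (e j)" using assms(1) by simp
    also have "\<dots> = poly p (e (j + c))" by (simp add: shz3_def poly_pcompose e_def add.commute)
    finally show ?thesis by simp
  qed
  have "poly p (e (int i * c)) = poly p (e 0)" for i
  proof (induction i)
    case (Suc i)
    thus ?case using step[of "int i * c"] by (simp add: algebra_simps)
  qed (simp add: e_def)
  hence "range (\<lambda>i. e (int i * c)) \<subseteq> {x. poly (p - [:poly p (e 0):]) x = 0}" by auto
  moreover have "inj (\<lambda>i. e (int i * c))"
    using assms(2) by (auto simp: inj_on_def e_def)
  ultimately have "infinite {x. poly (p - [:poly p (e 0):]) x = 0}"
    using range_inj_infinite infinite_super by blast
  hence "p - [:poly p (e 0):] = 0" using poly_roots_finite by blast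
  thus ?thesis by (metis degree_pCons_0 eq_iff_diff_eq_0)
qed

interpretation shift: ring_action "shift3 :: int \<times> int \<times> int \<Rightarrow> 'a::idom polyxyz \<Rightarrow> 'a polyxyz"
proof
  fix g h :: "int \<times> int \<times> int" and p q :: "'a polyxyz"
  show "shift3 g (p + q) = shift3 g p + shift3 g q"
    by (simp add: shift3_def shx3.hom_add shy3.hom_add shz3.hom_add split: prod.split)
  show "shift3 g (p * q) = shift3 g p * shift3 g q"
    by (simp add: shift3_def shx3.hom_mult shy3.hom_mult shz3.hom_mult split: prod.split)
  show "shift3 g 1 = (1 :: 'a polyxyz)"
    by (simp add: shift3_def split: prod.split)
  show "shift3 0 p = p"
    by (simp add: shift3_def zero_prod_def)
  show "shift3 g (shift3 h p) = shift3 (g + h) p"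
    by (simp add: shift3_def shx3_shy3[symmetric] shx3_shz3[symmetric] shy3_shz3[symmetric]
        shx3_shx3 shy3_shy3 shz3_shz3 split: prod.split)
qed

section \<open>Shifts of rational functions and the embedded field K(x)\<close>

lemma sig_eq_fract_act:
  fixes f :: "'a::idom ratxyz"
  shows
  "sigx a f = shift.fract_act (a, 0, 0) f"
  "sigy a f = shift.fract_act (0, a, 0) f"
  "sigz a f = shift.fract_act (0, 0, a) f"
proof -
  have "shift3 (a, 0, 0) = (shx3 a :: 'a polyxyz \<Rightarrow> _)" "shift3 (0, a, 0) = (shy3 a :: 'a polyxyz \<Rightarrow> _)"
    "shift3 (0, 0, a) = (shz3 a :: 'a polyxyz \<Rightarrow> _)"
    by (simp_all add: shift3_def fun_eq_iff)
  thus "sigx a f = shift.fract_act (a, 0, 0) f" "sigy a f = shift.fract_act (0, a, 0) f"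
    "sigz a f = shift.fract_act (0, 0, a) f"
    by (simp_all add: sigx_def sigy_def sigz_def shift.fract_act_def)
qed

lemma fract_act_rat3: "shift.fract_act g (rat3 p) = rat3 (shift3 g p)"
  by (simp add: rat3_def shift.fract_act_Fract)

lemma embx_Fract: "b \<noteq> 0 \<Longrightarrow> embx (Fract a b) = Fract [:[:a:]:] [:[:b:]:]"
  unfolding embx_def by (rule fract_map_Fract) auto

lemma embx_0 [simp]: "embx 0 = 0"
  by (simp add: Zero_fract_def embx_Fract eq_fract)

lemma embx_1 [simp]: "embx 1 = 1"
  by (simp add: One_fract_def embx_Fract eq_fract)

lemma embx_mult: "embx (f * g) = embx f * embx g"
  by (cases f; cases g) (simp add: embx_Fract)

lemma fract_act_embx: "shift.fract_act (0, b, c) (embx f) = embx f"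
  by (cases f) (simp add: embx_Fract shift.fract_act_Fract shift3_const_const)

lemma not_dvd_const_poly: "degree p > 0 \<Longrightarrow> b \<noteq> 0 \<Longrightarrow> \<not> p dvd [:b:]" for p :: "'b::idom poly"
  by (auto dest: dvd_imp_degree_le)

text \<open>Denominators from K(x) involve neither y nor z. The two cases cover both kinds of poles
  considered: primes involving z, and primes of K[x,y] involving y.\<close>

lemma regular_at_embx:
  assumes "degree p > 0 \<or> (\<exists>c. p = [:c:] \<and> degree c > 0)"
  shows "regular_at p (embx f)"
proof (cases f)
  case (Fract a b)
  have "\<not> p dvd [:[:b:]:]" 
    using assms Fract not_dvd_const_poly[of p "[:b:]"] not_dvd_const_poly[of _ b] by auto
  thus ?thesis using Fract by (simp add: embx_Fract regular_atI)
qed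

lemma inverse_rat3_power: "p \<noteq> 0 \<Longrightarrow> inverse (rat3 p ^ k) = Fract 1 (p ^ k)"
  by (induction k) (auto simp: rat3_def One_fract_def)

lemma regular_at_inverse_rat3_power:
  assumes "prime_elem p" "\<not> p dvd q"
  shows "regular_at p (inverse (rat3 q ^ k))"
proof -
  have "q \<noteq> 0" using assms(2) by auto
  moreover have "\<not> p dvd q ^ k" using assms(2) prime_elem_dvd_power[OF assms(1), of q k] by blast
  ultimately show ?thesis by (simp add: inverse_rat3_power regular_atI)
qed

section \<open>Summability and poles\<close>

lemma yz_summable_add: "yz_summable f \<Longrightarrow> yz_summable g \<Longrightarrow> yz_summable (f + g)"
proof -
  assume "yz_summable f" "yz_summable g"
  then obtain u v u' v' where "f = sigy 1 u - u + sigz 1 v - v" "g = sigy 1 u' - u' + sigz 1 v' - v'"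
    by (auto simp: yz_summable_def)
  hence "f + g = sigy 1 (u + u') - (u + u') + sigz 1 (v + v') - (v + v')"
    by (simp add: sig_eq_fract_act shift.fract_act_add)
  thus ?thesis unfolding yz_summable_def by blast
qed

lemma yz_summable_minus: "yz_summable f \<Longrightarrow> yz_summable (- f)"
proof -
  assume "yz_summable f"
  then obtain u v where "f = sigy 1 u - u + sigz 1 v - v"
    by (auto simp: yz_summable_def)
  hence "- f = sigy 1 (- u) - (- u) + sigz 1 (- v) - (- v)"
    by (simp add: sig_eq_fract_act shift.fract_act_minus)
  thus ?thesis unfolding yz_summable_def by blast
qed

lemma yz_summable_0 [simp]: "yz_summable 0"
proof -
  have "0 = sigy 1 0 - 0 + sigz 1 0 - (0 :: 'a ratxyz)" by (simp add: sig_eq_fract_act)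
  thus ?thesis unfolding yz_summable_def by blast
qed

lemma yz_summable_sum: "(\<And>i. i \<in> A \<Longrightarrow> yz_summable (f i)) \<Longrightarrow> yz_summable (sum f A)"
  by (induction A rule: infinite_finite_induct) (auto intro: yz_summable_add)

text \<open>By telescoping, the shifts whose differences are all summable form a group, and it
  contains the unit shifts in y and in z. Hence a term may be moved by any shift in y and z modulo
  summable functions.\<close>

lemma yz_summable_difference: "yz_summable (shift.fract_act (0, b, c) f - f)"
proof -
  define S where "S h \<longleftrightarrow> (\<forall>f. yz_summable (shift.fract_act h f - f :: 'a ratxyz))" for h
  have add: "S (h + h')" if "S h" "S h'" for h h'
    unfolding S_def
  proof
    fix f :: "'a ratxyz"
    have "shift.fract_act (h + h') f - f = (shift.fract_act h (shift.fract_act h' f) - shift.fract_act h' f)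
        + (shift.fract_act h' f - f)"
      by (simp add: shift.fract_act_fract_act)
    thus "yz_summable (shift.fract_act (h + h') f - f)"
      using that unfolding S_def by (metis yz_summable_add)
  qed
  have minus: "S (- h)" if "S h" for h
    unfolding S_def
  proof
    fix f :: "'a ratxyz"
    have "shift.fract_act (- h) f - f =
        - (shift.fract_act h (shift.fract_act (- h) f) - shift.fract_act (- h) f)"
      by (simp add: shift.fract_act_fract_act)
    thus "yz_summable (shift.fract_act (- h) f - f)"
      using that unfolding S_def by (metis yz_summable_minus)
  qed
  have nat: "S (0, int i * b, int i * c)" if "S (0, b, c)" for i b c
  proof (induction i)
    case 0
    show ?case by (simp add: S_def zero_prod_def[symmetric])
  next
    case (Suc i)
    thus ?case using add[OF that Suc.IH] by (simp add: algebra_simps)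
  qed
  have int: "S (0, j * b, j * c)" if "S (0, b, c)" for j b c
  proof (cases "j \<ge> 0")
    case True
    thus ?thesis using nat[OF that, of "nat j"] by simp
  next
    case False
    thus ?thesis using minus[OF nat[OF that, of "nat (- j)"]] by simp
  qed
  have "S (0, 1, 0)" unfolding S_def
  proof
    fix f :: "'a ratxyz"
    have "shift.fract_act (0, 1, 0) f - f = sigy 1 f - f + sigz 1 0 - 0"
      by (simp add: sig_eq_fract_act)
    thus "yz_summable (shift.fract_act (0, 1, 0) f - f)" unfolding yz_summable_def by blast
  qed
  moreover have "S (0, 0, 1)" unfolding S_def
  proof
    fix f :: "'a ratxyz"
    have "shift.fract_act (0, 0, 1) f - f = sigy 1 0 - 0 + sigz 1 f - f"
      by (simp add: sig_eq_fract_act)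
    thus "yz_summable (shift.fract_act (0, 0, 1) f - f)" unfolding yz_summable_def by blast
  qed
  ultimately have "S ((0, b, 0) + (0, 0, c))"
    using int[of 1 0 b] int[of 0 1 c] by (intro add) simp_all
  thus ?thesis by (simp add: S_def)
qed

text \<open>With the denominator split as \<open>q ^ e * b'\<close> and
  \<open>u * q ^ e + v * b' = [:c:]\<close>, the fraction equals
  \<open>a * u / (c * b') + a * v / (c * q ^ e)\<close>. The second summand is \<open>g\<close>: its
  denominator has no prime divisor of positive degree other than \<open>q\<close> up to
  units.\<close>

lemma polar_part_exists:
  fixes q :: "'b::idom poly"
  assumes q: "prime_elem q" "degree q > 0"
  shows "\<exists>g. regular_at q (f - g) \<and>
    (\<forall>p. prime_elem p \<longrightarrow> degree p > 0 \<longrightarrow> \<not> p dvd q \<longrightarrow> regular_at p g)"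
proof (cases f)
  case (Fract a b)
  then obtain e b' where b': "b = q ^ e * b'" "\<not> q dvd b'"
    using poly_split_power[OF q(2), of b] by blast
  obtain u v c where c: "c \<noteq> 0" "u * q ^ e + v * b' = [:c:]"
    using bezout_const_poly_power[OF q b'(2)] by blast
  have nz: "q ^ e \<noteq> 0" "b' \<noteq> 0" "[:c:] \<noteq> 0" using q b' c by auto
  define g where "g = Fract (a * v) ([:c:] * q ^ e)"
  have "f - g = Fract (a * ([:c:] - v * b') * q ^ e) (q ^ e * b' * ([:c:] * q ^ e))"
    unfolding Fract(1) g_def b'(1) using nz by (simp only: diff_fract mult_eq_0_iff simp_thms) (simp add: algebra_simps)
  also have "[:c:] - v * b' = u * q ^ e" using c(2) by (simp add: algebra_simps)
  also have "Fract (a * (u * q ^ e) * q ^ e) (q ^ e * b' * ([:c:] * q ^ e)) = Fract (a * u) ([:c:] * b')"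
  proof (subst eq_fract(1))
    show "a * (u * q ^ e) * q ^ e * ([:c:] * b') = a * u * (q ^ e * b' * ([:c:] * q ^ e))"
      by (simp only: ac_simps)
  qed (use nz in auto)
  finally have fg: "f - g = Fract (a * u) ([:c:] * b')" .
  have "\<not> q dvd [:c:]" using q(2) c(1) by (rule not_dvd_const_poly)
  hence "\<not> q dvd [:c:] * b'" using b'(2) prime_elem_dvd_mult_iff[OF q(1)] by blast
  hence "regular_at q (f - g)" unfolding fg by (rule regular_atI)
  moreover have "regular_at p g" if p: "prime_elem p" "degree p > 0" "\<not> p dvd q" for p
  proof -
    have "\<not> p dvd [:c:]" using p(2) c(1) by (rule not_dvd_const_poly)
    moreover have "\<not> p dvd q ^ e" using p(3) prime_elem_dvd_power[OF p(1), of q e] by blast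
    ultimately have "\<not> p dvd [:c:] * q ^ e" using prime_elem_dvd_mult_iff[OF p(1)] by blast
    thus ?thesis unfolding g_def by (rule regular_atI)
  qed
  ultimately show ?thesis by blast
qed

text \<open>All translates of \<open>p\<close> share \<open>lead_coeff3\<close>. This turns
  divisibility between orbit points into equations between shifts, the form in which the hypotheses
  on \<open>d\<close> are stated.\<close>

lemma shift3_dvd_imp_eq:
  fixes p :: "'a::field polyxyz"
  assumes "prime_elem p" "shift3 g p dvd shift3 h p"
  shows "shift3 g p = shift3 h p"
proof (rule dvd_imp_eq_if_lead_coeff3_eq[OF _ _ assms(2)])
  show "prime_elem (shift3 g p)" "prime_elem (shift3 h p)"
    by (rule shift.prime_elem_act[THEN iffD2, OF assms(1)])+
  show "lead_coeff3 (shift3 g p) = lead_coeff3 (shift3 h p)" by simp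
qed

text \<open>The orbit invariant is applied to the group \<open>H\<close> of shifts that leave x
  alone. Freeness makes the translates of \<open>q\<close> pairwise non-associate, which yields both
  finiteness of the poles and isolated polar parts.\<close>

lemma yz_summable_imp_regular_at:
  fixes q :: "'a::field polyxyz"
  assumes q: "prime_elem q" "degree q > 0"
    and free: "\<And>b c. (b, c) \<noteq> (0, 0) \<Longrightarrow> shift3 (0, b, c) q \<noteq> q"
    and f: "yz_summable f"
    and reg: "\<And>b c. (b, c) \<noteq> (0, 0) \<Longrightarrow> regular_at (shift3 (0, b, c) q) f"
  shows "regular_at q f"
proof -
  define H :: "(int \<times> int \<times> int) set" where "H = {g. fst g = 0}"
  have prime: "prime_elem (shift3 t q)" for t
    using q(1) by (simp only: shift.prime_elem_act)
  have nodvd: "\<not> shift3 s q dvd shift3 t q" if st: "s \<in> H" "t \<in> H" "s \<noteq> t" for s t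
  proof
    assume "shift3 s q dvd shift3 t q"
    hence "shift3 s q = shift3 t q" by (rule shift3_dvd_imp_eq[OF q(1)])
    hence "shift3 (t - s) q = q"
      by (metis shift.act_act shift.act_uminus_cancel(1) diff_conv_add_uminus add.commute)
    moreover obtain b c where bc: "t - s = (0, b, c)"
      using st by (cases s; cases t) (auto simp: H_def)
    moreover have "(b, c) \<noteq> (0, 0)" using st(3) bc by (auto simp: zero_prod_def[symmetric])
    ultimately show False using free by metis
  qed
  obtain u v where uv: "f = sigy 1 u - u + sigz 1 v - v" using f by (auto simp: yz_summable_def)
  show ?thesis
  proof (rule shift.regular_at_if_difference[of H])
    show "0 \<in> H" "\<And>s t. s \<in> H \<Longrightarrow> t \<in> H \<Longrightarrow> s - t \<in> H" by (auto simp: H_def)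
    show "(0, 1, 0) \<in> H" "(0, 0, 1) \<in> H" by (auto simp: H_def)
    show "f = shift.fract_act (0, 1, 0) u - u + (shift.fract_act (0, 0, 1) v - v)"
      using uv by (simp add: sig_eq_fract_act)
    show "regular_at (shift3 t q) f" if "t \<in> H" "t \<noteq> 0" for t
      using reg that by (cases t) (auto simp: H_def zero_prod_def)
    show "finite {t \<in> H. \<not> regular_at (shift3 t q) f}" for f
    proof (cases f)
      case (Fract a b)
      show ?thesis
      proof (rule finite_prime_divisors_poly[OF Fract(2), where p = "\<lambda>t. shift3 t q"])
        fix t assume t: "t \<in> {t \<in> H. \<not> regular_at (shift3 t q) f}"
        show "prime_elem (shift3 t q)" by (rule prime)
        show "degree (shift3 t q) > 0" using q(2) by simp
        show "shift3 t q dvd b" using t Fract regular_atI by blast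
        fix s assume s: "s \<in> {t \<in> H. \<not> regular_at (shift3 t q) f}" "s \<noteq> t"
        show "\<not> shift3 s q dvd shift3 t q" using nodvd[of s t] s t by blast
      qed
    qed
    show "\<exists>g. regular_at q (f - g) \<and> (\<forall>t\<in>H. t \<noteq> 0 \<longrightarrow> regular_at (shift3 t q) g)" for f
    proof -
      obtain g where fg: "regular_at q (f - g)"
        and g: "\<And>p. prime_elem p \<Longrightarrow> degree p > 0 \<Longrightarrow> \<not> p dvd q \<Longrightarrow> regular_at p g"
        using polar_part_exists[OF q] by metis
      have "regular_at (shift3 t q) g" if "t \<in> H" "t \<noteq> 0" for t
      proof (rule g)
        show "\<not> shift3 t q dvd q" using nodvd[of t 0] that by (simp add: H_def)
      qed (use prime q(2) in auto)
      thus ?thesis using fg by blast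
    qed
  qed (rule q(1))
qed

section \<open>Proper fractions and recurrences\<close>

lemma regular_at_dvd: "regular_at p f \<Longrightarrow> p dvd q \<Longrightarrow> regular_at q f"
  unfolding regular_at_def using dvd_trans by blast

text \<open>These are the polynomials in z over K(x,y) of degree below \<open>D\<close>, with a
  common denominator \<open>B\<close>. The disjunct \<open>A = 0\<close> keeps the zero function
  when \<open>D = 0\<close>.\<close>

definition z_proper :: "nat \<Rightarrow> 'a::idom ratxyz \<Rightarrow> bool" where
  "z_proper D f \<longleftrightarrow> (\<exists>A B. B \<noteq> 0 \<and> f = Fract A [:B:] \<and> (A = 0 \<or> degree A < D))"

lemma z_proper_0 [simp]: "z_proper D 0"
  unfolding z_proper_def by (intro exI[of _ 0] exI[of _ 1]) (simp add: Zero_fract_def eq_fract)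

lemma degree_mult_const_eq: "b \<noteq> 0 \<Longrightarrow> degree (p * [:b:]) = degree p" for p :: "'b::idom poly"
  by (cases "p = 0") (auto simp: degree_mult_eq simp del: mult_pCons_right)

lemma z_proper_add:
  assumes "z_proper D f" "z_proper D g"
  shows "z_proper D (f + g)"
proof -
  from assms obtain A B A' B' where
    f: "B \<noteq> 0" "f = Fract A [:B:]" "A = 0 \<or> degree A < D" and
    g: "B' \<noteq> 0" "g = Fract A' [:B':]" "A' = 0 \<or> degree A' < D"
    unfolding z_proper_def by blast
  have "f + g = Fract (A * [:B':] + A' * [:B:]) ([:B:] * [:B':])"
    unfolding f(2) g(2) by (rule add_fract) (use f(1) g(1) in auto)
  moreover have "[:B:] * [:B':] = [:B * B':]" by simp
  moreover have "A * [:B':] + A' * [:B:] = 0 \<or> degree (A * [:B':] + A' * [:B:]) < D"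
  proof (cases "A = 0 \<or> A' = 0")
    case True
    thus ?thesis using f g degree_mult_const_eq[of B A'] degree_mult_const_eq[of B' A] by auto
  next
    case False
    have "degree (A * [:B':] + A' * [:B:]) \<le> max (degree (A * [:B':])) (degree (A' * [:B:]))"
      by (rule degree_add_le_max)
    also have "\<dots> < D" using False f(3) g(3)
      unfolding degree_mult_const_eq[OF f(1)] degree_mult_const_eq[OF g(1)] by simp
    finally show ?thesis ..
  qed
  moreover have "B * B' \<noteq> 0" using f(1) g(1) by simp
  ultimately show ?thesis unfolding z_proper_def by metis
qed

lemma z_proper_sum: "(\<And>i. i \<in> S \<Longrightarrow> z_proper D (f i)) \<Longrightarrow> z_proper D (sum f S)"
  by (induction S rule: infinite_finite_induct) (auto intro: z_proper_add)

lemma z_proper_embx_mult: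
  assumes "z_proper D f"
  shows "z_proper D (embx l * f)"
proof (cases l)
  case (Fract a b)
  from assms obtain A B where f: "B \<noteq> 0" "f = Fract A [:B:]" "A = 0 \<or> degree A < D"
    unfolding z_proper_def by blast
  have "embx l * f = Fract ([:[:a:]:] * A) [:[:b:] * B:]"
    using Fract by (simp add: embx_Fract f(2))
  moreover have "[:b:] * B \<noteq> 0" using Fract f(1) by simp
  moreover have "[:[:a:]:] * A = 0 \<or> degree ([:[:a:]:] * A) < D"
    using f(3) degree_smult_le[of "[:a:]" A] by auto
  ultimately show ?thesis unfolding z_proper_def by metis
qed

lemma z_proper_fract_act:
  assumes "z_proper D f"
  shows "z_proper D (shift.fract_act g f)"
proof -
  from assms obtain A B where f: "B \<noteq> 0" "f = Fract A [:B:]" "A = 0 \<or> degree A < D"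
    unfolding z_proper_def by blast
  obtain a b e where g: "g = (a, b, e)" by (cases g)
  have "shift.fract_act g f = Fract (shift3 g A) [:shx2 a (shy2 b B):]"
    unfolding f(2) using f(1) by (simp add: shift.fract_act_Fract g shift3_const)
  moreover have "shx2 a (shy2 b B) \<noteq> 0" using f(1) shx2_eq_0 shy2_eq_0 by blast
  ultimately show ?thesis using f(3) unfolding z_proper_def
    by (metis degree_shift3 shift.act_0)
qed

lemma z_proper_imp_regular_at: "z_proper D f \<Longrightarrow> degree p > 0 \<Longrightarrow> regular_at p f"
  unfolding z_proper_def using not_dvd_const_poly regular_atI by metis

text \<open>Regularity after division by a positive power of \<open>q\<close> forces
  \<open>q\<close> to divide the numerator, whose degree in z is too small for that.\<close>

lemma z_proper_regular_at_imp_0: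
  assumes f: "z_proper (degree q) f" and q: "prime_elem q" and "k > 0"
    and reg: "regular_at q (inverse (rat3 q ^ k) * f)"
  shows "f = 0"
proof -
  from f obtain A B where f: "B \<noteq> 0" "f = Fract A [:B:]" "A = 0 \<or> degree A < degree q"
    unfolding z_proper_def by blast
  have "q \<noteq> 0" using q by (rule prime_elem_not_zeroI)
  have "inverse (rat3 q ^ k) * f = Fract A (q ^ k * [:B:])"
    unfolding f(2) inverse_rat3_power[OF \<open>q \<noteq> 0\<close>] by simp
  moreover obtain E G where EG: "inverse (rat3 q ^ k) * f = Fract E G" "\<not> q dvd G"
    using reg by (auto simp only: regular_at_def)
  moreover have "G \<noteq> 0" using EG(2) by auto
  moreover have "q ^ k * [:B:] \<noteq> 0" using \<open>q \<noteq> 0\<close> f(1) by auto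
  ultimately have "A * G = E * (q ^ k * [:B:])" by (metis eq_fract(1))
  moreover have "q dvd q ^ k" using \<open>k > 0\<close> by (simp add: dvd_power)
  ultimately have "q dvd A * G" by (metis dvd_mult dvd_mult2)
  hence "q dvd A" using EG(2) prime_elem_dvd_mult_iff[OF q] by blast
  hence "A = 0" using f(3) dvd_imp_degree_le[of q A] linorder_not_le by metis
  thus ?thesis using f(1,2) by (simp add: Zero_fract_def eq_fract)
qed

text \<open>Every z-coefficient is a proper fraction in y over K(x). The denominator is kept as a
  multiset of factors from \<open>C\<close>, a form that is stable under addition and shows where
  poles can lie.\<close>

definition y_proper :: "'a::idom polyxy set \<Rightarrow> 'a ratxyz \<Rightarrow> bool" where
  "y_proper C f \<longleftrightarrow> (\<exists>A M. set_mset M \<subseteq> C \<and> f = Fract A [:prod_mset M:] \<and>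
     (\<forall>e. coeff A e = 0 \<or> degree (coeff A e) < degree (prod_mset M)))"

lemma y_proper_0: "y_proper C 0"
  unfolding y_proper_def by (intro exI[of _ 0] exI[of _ "{#}"]) (simp add: Zero_fract_def eq_fract)

lemma y_proper_add:
  assumes C: "0 \<notin> C" and "y_proper C f" "y_proper C g"
  shows "y_proper C (f + g)"
proof -
  from assms obtain A M A' M' where
    f: "set_mset M \<subseteq> C" "f = Fract A [:prod_mset M:]"
      "\<And>e. coeff A e = 0 \<or> degree (coeff A e) < degree (prod_mset M)" and
    g: "set_mset M' \<subseteq> C" "g = Fract A' [:prod_mset M':]"
      "\<And>e. coeff A' e = 0 \<or> degree (coeff A' e) < degree (prod_mset M')"
    unfolding y_proper_def by metis
  define B B' where "B = prod_mset M" and "B' = prod_mset M'"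
  have nz: "B \<noteq> 0" "B' \<noteq> 0" using C f(1) g(1) by (auto simp: B_def B'_def prod_mset_zero_iff)
  have "f + g = Fract (A * [:B':] + A' * [:B:]) ([:B:] * [:B':])"
    unfolding f(2) g(2) B_def[symmetric] B'_def[symmetric] by (rule add_fract) (use nz in auto)
  hence "f + g = Fract (A * [:B':] + A' * [:B:]) [:prod_mset (M + M'):]"
    by (simp add: B_def B'_def mult.commute)
  moreover have "coeff (A * [:B':] + A' * [:B:]) e = 0 \<or>
      degree (coeff (A * [:B':] + A' * [:B:]) e) < degree (prod_mset (M + M'))" for e
  proof -
    have deg: "degree (prod_mset (M + M')) = degree B + degree B'"
      using nz by (simp add: B_def B'_def degree_mult_eq)
    have "coeff A e * B' = 0 \<or> degree (coeff A e * B') < degree B + degree B'"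
      using f(3)[of e] nz by (cases "coeff A e = 0") (auto simp: B_def degree_mult_eq)
    moreover have "coeff A' e * B = 0 \<or> degree (coeff A' e * B) < degree B + degree B'"
      using g(3)[of e] nz by (cases "coeff A' e = 0") (auto simp: B'_def degree_mult_eq)
    moreover have "coeff (A * [:B':] + A' * [:B:]) e = coeff A e * B' + coeff A' e * B"
      by (simp add: mult.commute)
    ultimately show ?thesis unfolding deg
      by (metis add_0 add_0_right degree_add_less)
  qed
  moreover have "set_mset (M + M') \<subseteq> C" using f(1) g(1) by simp
  ultimately show ?thesis unfolding y_proper_def by blast
qed

lemma y_proper_sum:
  "0 \<notin> C \<Longrightarrow> (\<And>i. i \<in> S \<Longrightarrow> y_proper C (f i)) \<Longrightarrow> y_proper C (sum f S)"
  by (induction S rule: infinite_finite_induct) (auto intro: y_proper_add y_proper_0)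

text \<open>Regularity at one factor lets it be cancelled from the numerator. The fraction stays the
  same function, so the assumptions persist for the remaining factors, repeated ones
  included.\<close>

lemma regular_at_prime_factors_imp_poly:
  fixes M :: "'r::idom multiset"
  assumes "\<And>c. c \<in># M \<Longrightarrow> prime_elem c" "\<And>c. c \<in># M \<Longrightarrow> regular_at c (Fract A (prod_mset M))"
  shows "prod_mset M dvd A"
  using assms
proof (induction M arbitrary: A)
  case (add c M)
  have c: "prime_elem c" using add.prems by simp
  have nz: "c \<noteq> 0" "prod_mset M \<noteq> 0"
    using add.prems(1) prime_elem_not_zeroI by (fastforce simp: prod_mset_zero_iff)+
  obtain E G where EG: "Fract A (c * prod_mset M) = Fract E G" "\<not> c dvd G"
    using add.prems(2)[of c] by (auto simp: regular_at_def)
  moreover have "G \<noteq> 0" using EG(2) by auto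
  moreover have "c * prod_mset M \<noteq> 0" using nz by simp
  ultimately have "A * G = E * (c * prod_mset M)" by (metis eq_fract(1))
  hence "c dvd A * G" by (metis dvd_triv_left dvd_mult dvd_mult2)
  hence "c dvd A" using EG(2) prime_elem_dvd_mult_iff[OF c] by blast
  then obtain A1 where A1: "A = c * A1" by (auto simp: dvd_def)
  have eq: "Fract A (prod_mset (add_mset c M)) = Fract A1 (prod_mset M)"
    using nz by (simp add: A1 eq_fract)
  have "prod_mset M dvd A1"
  proof (rule add.IH)
    fix c' assume "c' \<in># M"
    thus "prime_elem c'" "regular_at c' (Fract A1 (prod_mset M))"
      using add.prems[of c'] unfolding eq by simp_all
  qed
  thus ?case by (simp add: A1)
qed simp

text \<open>Without poles the denominator divides the numerator, hence each of its z-coefficients;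
  the bound on the degrees in y leaves only zero.\<close>

lemma y_proper_regular_imp_0:
  assumes f: "y_proper C f" and C: "\<And>c. c \<in> C \<Longrightarrow> prime_elem c"
    and reg: "\<And>c. c \<in> C \<Longrightarrow> regular_at [:c:] f"
  shows "f = 0"
proof -
  from f obtain A M where
    f: "set_mset M \<subseteq> C" "f = Fract A [:prod_mset M:]"
      "\<And>e. coeff A e = 0 \<or> degree (coeff A e) < degree (prod_mset M)"
    unfolding y_proper_def by metis
  define M' where "M' = image_mset (\<lambda>c. [:c:]) M"
  have prod: "prod_mset M' = [:prod_mset M:]"
    unfolding M'_def by (induction M) auto
  have "prod_mset M' dvd A"
  proof (rule regular_at_prime_factors_imp_poly)
    fix p assume "p \<in># M'"
    then obtain c where c: "c \<in> C" "p = [:c:]" using f(1) by (auto simp: M'_def)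
    show "prime_elem p" unfolding c(2) prime_elem_const_poly_iff by (rule C[OF c(1)])
    show "regular_at p (Fract A (prod_mset M'))"
      using reg[OF c(1)] unfolding prod c(2) f(2) .
  qed
  then obtain Q where Q: "A = [:prod_mset M:] * Q" unfolding prod by (auto simp: dvd_def)
  have nz: "prod_mset M \<noteq> 0"
    using C f(1) prime_elem_not_zeroI by (fastforce simp: prod_mset_zero_iff)
  have "coeff A e = 0" for e
  proof (rule ccontr)
    assume *: "coeff A e \<noteq> 0"
    have "coeff A e = prod_mset M * coeff Q e" unfolding Q by simp
    hence "degree (coeff A e) \<ge> degree (prod_mset M)" using * by (simp add: degree_mult_eq)
    thus False using f(3)[of e] * by simp
  qed
  hence "A = 0" by (simp add: poly_eq_iff)
  thus ?thesis using nz f(2) by (simp add: Zero_fract_def eq_fract)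
qed

text \<open>The pole \<open>p\<close> divides the denominator, hence one of its irreducible factors
  \<open>c\<close>, so the two are associates. The direction \<open>[:c:] dvd [:p:]\<close> is the
  one that carries the pole over to \<open>c\<close>.\<close>

lemma y_proper_pole:
  fixes p :: "'a::field polyxy"
  assumes f: "y_proper C f" and C: "\<And>c. c \<in> C \<Longrightarrow> prime_elem c"
    and p: "prime_elem p" "\<not> regular_at [:p:] f"
  shows "\<exists>c\<in>C. [:c:] dvd [:p:] \<and> \<not> regular_at [:c:] f"
proof -
  from f obtain A M where f: "set_mset M \<subseteq> C" "f = Fract A [:prod_mset M:]"
    unfolding y_proper_def by metis
  have "[:p:] dvd [:prod_mset M:]" using p(2) regular_atI f(2) by blast
  hence "p dvd prod_mset M" by simp
  then obtain c where c: "c \<in># M" "p dvd c" using prime_elem_dvd_prod_msetE[OF p(1)] by blast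
  have "irreducible c" using C[of c] f(1) c(1) by auto
  moreover obtain u where u: "c = p * u" using c(2) by (auto simp: dvd_def)
  moreover have "\<not> p dvd 1" using p(1) by (rule prime_elem_not_unit)
  ultimately have "u dvd 1" by (metis irreducibleD)
  hence "c dvd p" using u by (metis dvd_refl mult_unit_dvd_iff)
  hence "[:c:] dvd [:p:]" by simp
  moreover have "\<not> regular_at [:c:] f" using regular_at_dvd calculation p(2) by blast
  ultimately show ?thesis using c(1) f(1) by blast
qed

text \<open>Let P be the set of poles of a. Since no pole is fixed by a positive power of the shift
  (m, - n, - k), the finite set P has an element whose positive translates all lie outside P;
  the translate of this pole under the leading term is not cancelled by any other term.\<close>

lemma shift_recurrence_imp_0:
  fixes a :: "'a::field ratxyz" and m n k :: int and h :: "int \<times> int \<times> int"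
  defines "g \<equiv> \<lambda>t. (m * t, - n * t, - k * t)"
  assumes C: "finite C" "\<And>c. c \<in> C \<Longrightarrow> prime_elem c" "\<And>c. c \<in> C \<Longrightarrow> degree c > 0"
    and C_shift: "\<And>c t. c \<in> C \<Longrightarrow> t > 0 \<Longrightarrow> shx2 (t * m) c \<noteq> shy2 (t * n) c"
    and a: "y_proper C a"
    and S: "finite S" "0 \<in> S" "\<And>t. t \<in> S \<Longrightarrow> t \<ge> 0" and l: "l 0 \<noteq> 0"
    and eq: "(\<Sum>t\<in>S. embx (l t) * shift.fract_act (h - g t) a) = 0"
  shows "a = 0"
proof (rule y_proper_regular_imp_0[OF a C(2)])
  have const: "shift3 (x, y, z) [:c:] = [:shx2 x (shy2 y c):]" for x y z and c :: "'a polyxy"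
    by (rule shift3_const)
  have prime: "prime_elem (shift3 t [:c:])" if "c \<in> C" for c t
    by (rule shift.prime_elem_act[THEN iffD2], subst prime_elem_const_poly_iff, rule C(2)[OF that])
  define P where "P = {c \<in> C. \<not> regular_at [:c:] a}"
  \<comment> \<open>On \<open>C\<close> this means that \<open>c'\<close> is, up to a unit, a later
    point of the orbit of \<open>c\<close>. The hypothesis on the \<open>c i\<close> makes it
    irreflexive, so a finite set of poles has a maximal element.\<close>
  define R where "R c c' \<longleftrightarrow> (\<exists>t>0. [:c':] dvd shift3 (g t) [:c:])" for c c' :: "'a polyxy"
  have trans: "R c c''" if R: "R c c'" "R c' c''" for c c' c''
  proof -
    from R obtain t t' where t: "t > 0" "[:c':] dvd shift3 (g t) [:c:]"
      "t' > 0" "[:c'':] dvd shift3 (g t') [:c':]" by (auto simp: R_def)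
    note t(4)
    also have "shift3 (g t') [:c':] dvd shift3 (g t') (shift3 (g t) [:c:])"
      by (rule shift.act_dvd_iff[THEN iffD2, OF t(2)])
    also have "\<dots> = shift3 (g (t' + t)) [:c:]"
      unfolding shift.act_act by (simp add: g_def algebra_simps)
    finally show ?thesis using t unfolding R_def by (meson add_pos_pos)
  qed
  have irrefl: "\<not> R c c" if c: "c \<in> C" for c
  proof
    assume "R c c"
    then obtain t where t: "t > 0" "[:c:] dvd shift3 (g t) [:c:]" by (auto simp: R_def)
    have "prime_elem [:c:]" using C(2)[OF c] by (simp only: prime_elem_const_poly_iff)
    hence "shift3 0 [:c:] = shift3 (g t) [:c:]"
      by (rule shift3_dvd_imp_eq) (use t(2) in simp)
    hence "c = shx2 (m * t) (shy2 (- n * t) c)" by (simp add: g_def const)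
    hence "shy2 (n * t) c = shy2 (n * t) (shx2 (m * t) (shy2 (- n * t) c))" by simp
    also have "\<dots> = shx2 (m * t) c"
      by (simp add: shx2_shy2[symmetric] shy2_shy2)
    finally show False using C_shift[OF c t(1)] by (simp add: mult.commute)
  qed
  have "P = {}"
  proof (rule ccontr)
    assume "P \<noteq> {}"
    moreover have "finite P" using C(1) by (simp add: P_def)
    moreover have "asymp_on P R" using trans irrefl by (auto simp: asymp_on_def P_def)
    moreover have "transp_on P R" using trans by (auto simp: transp_on_def)
    ultimately obtain c where c: "c \<in> P" "\<And>c'. c' \<in> P \<Longrightarrow> c' \<noteq> c \<Longrightarrow> \<not> R c c'"
      using Finite_Set.bex_max_element[of P R] by blast
    have cC: "c \<in> C" "\<not> regular_at [:c:] a" using c(1) by (auto simp: P_def)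
    have max: "\<not> R c c'" if "c' \<in> P" for c' using c(2)[OF that] irrefl[OF cC(1)] by blast
    define q where "q = shift3 h [:c:]"
    have q: "prime_elem q" unfolding q_def by (rule prime[OF cC(1)])
    have regembx: "regular_at q (embx f)" for f
    proof (rule regular_at_embx)
      obtain x y z where h: "h = (x, y, z)" by (cases h)
      have "degree (shx2 x (shy2 y c)) > 0" using C(3)[OF cC(1)] by (simp add: degree_shift2)
      thus "0 < degree q \<or> (\<exists>c. q = [:c:] \<and> 0 < degree c)" unfolding q_def h const by blast
    qed
    \<comment> \<open>A pole of this term at \<open>q\<close> is a pole of \<open>a\<close> at the
      translate of \<open>[:c:]\<close> by \<open>g t\<close>, which would put an element of
      \<open>P\<close> above the maximal \<open>c\<close>.\<close>
    have reg: "regular_at q (shift.fract_act (h - g t) a)" if t: "t > 0" for t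
    proof (rule ccontr)
      assume "\<not> regular_at q (shift.fract_act (h - g t) a)"
      moreover have "shift3 (- (h - g t)) q = shift3 (g t) [:c:]"
        by (simp add: q_def shift.act_act)
      ultimately have nr: "\<not> regular_at (shift3 (g t) [:c:]) a"
        by (simp add: shift.regular_at_fract_act_shift)
      define p where "p = shx2 (m * t) (shy2 (- n * t) c)"
      have p: "shift3 (g t) [:c:] = [:p:]" by (simp add: g_def const p_def)
      have "prime_elem [:p:]" unfolding p[symmetric] by (rule prime[OF cC(1)])
      hence p_prime: "prime_elem p" by (simp only: prime_elem_const_poly_iff)
      obtain c' where "c' \<in> C" "[:c':] dvd [:p:]" "\<not> regular_at [:c':] a"
        using y_proper_pole[OF a C(2) p_prime nr[unfolded p]] by blast
      hence "c' \<in> P" "R c c'" using t p by (auto simp: P_def R_def)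
      thus False using max by blast
    qed
    \<comment> \<open>Solving the recurrence for the term \<open>t = 0\<close> expresses the shift
      of \<open>a\<close> by \<open>h\<close> through functions regular at \<open>q\<close>,
      although \<open>c\<close> is a pole of \<open>a\<close>.\<close>
    define Z where "Z = (\<Sum>t\<in>S - {0}. embx (l t) * shift.fract_act (h - g t) a)"
    have "regular_at q Z" unfolding Z_def
    proof (rule regular_at_sum[OF q])
      fix t assume "t \<in> S - {0}"
      hence "t > 0" using S(3)[of t] by auto
      thus "regular_at q (embx (l t) * shift.fract_act (h - g t) a)"
        using regular_at_mult[OF q regembx reg] by blast
    qed
    hence "regular_at q (embx (inverse (l 0)) * - Z)"
      using regular_at_mult[OF q regembx regular_at_minus] by blast
    moreover have "shift.fract_act h a = embx (inverse (l 0)) * - Z"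
    proof -
      have "g 0 = 0" by (simp add: g_def zero_prod_def)
      hence "embx (l 0) * shift.fract_act h a = - Z"
        using eq S(1,2) by (simp add: Z_def sum.remove[of S 0] eq_neg_iff_add_eq_0)
      hence "embx (inverse (l 0)) * - Z = embx (inverse (l 0) * l 0) * shift.fract_act h a"
        by (simp add: embx_mult mult.assoc)
      thus ?thesis using l by simp
    qed
    ultimately have "regular_at q (shift.fract_act h a)" by simp
    thus False using cC(2) by (simp add: q_def)
  qed
  thus "regular_at [:c:] a" if "c \<in> C" for c using that by (auto simp: P_def)
qed

section \<open>Properness of the given summands, and multiples of the shift that fixes
  \<open>d\<close>\<close>

lemma z_proper_divide_const:
  assumes "B \<noteq> 0" "degree A < D"
  shows "z_proper D (rat3 A / rat3 [:B:])"
proof -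
  have "rat3 A / rat3 [:B:] = Fract A [:B:]" by (simp add: rat3_def)
  thus ?thesis using assms unfolding z_proper_def by metis
qed

lemma degree_coeff_le_degy3: "degree (coeff p e) \<le> degy3 p"
proof (cases "e \<le> degree p")
  case True
  thus ?thesis unfolding degy3_def by (intro Max_ge) auto
next
  case False
  thus ?thesis by (simp add: coeff_eq_0)
qed

lemma y_proper_divide_power:
  fixes c :: "'a::field polyxy"
  assumes "c \<in> C" "c \<noteq> 0" "l > 0" "degy3 A < degree c"
  shows "y_proper C (rat3 A / rat3 ([:c:] ^ l))"
proof -
  have "rat3 A / rat3 ([:c:] ^ l) = Fract A [:prod_mset (replicate_mset l c):]"
    by (simp add: rat3_def poly_const_pow)
  moreover have "degree (coeff A e) < degree (prod_mset (replicate_mset l c))" for e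
  proof -
    have "degree (coeff A e) < degree c" using degree_coeff_le_degy3[of A e] assms(4) by simp
    also have "\<dots> \<le> l * degree c" using assms(3) by simp
    also have "\<dots> = degree (prod_mset (replicate_mset l c))"
      using assms(2) by (simp add: degree_power_eq)
    finally show ?thesis .
  qed
  moreover have "set_mset (replicate_mset l c) \<subseteq> C" using assms(1) by (auto split: if_splits)
  ultimately show ?thesis unfolding y_proper_def by blast
qed

text \<open>The shift by \<open>(m, - n, - k)\<close> fixes \<open>d\<close>, and so does the whole
  cyclic group that it generates, negative multiples included.\<close>

lemma shift3_multiple:
  fixes d :: "'a::idom polyxyz"
  assumes "shift3 (m, 0, 0) d = shift3 (0, n, k) d"
  shows "shift3 (m * w, 0, 0) d = shift3 (0, n * w, k * w) d"
proof -
  have fix1: "shift3 (m, - n, - k) d = d"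
    using arg_cong[OF assms, of "shift3 (0, - n, - k)"]
    by (simp add: shift.act_act) (simp add: zero_prod_def[symmetric])
  have nat: "shift3 (m * int j, - n * int j, - k * int j) d = d" for j
  proof (induction j)
    case 0
    show ?case by (simp add: zero_prod_def[symmetric])
  next
    case (Suc j)
    have "shift3 (m, - n, - k) (shift3 (m * int j, - n * int j, - k * int j) d) = d"
      by (simp only: Suc.IH fix1)
    thus ?case by (simp add: shift.act_act algebra_simps)
  qed
  have int: "shift3 (m * w, - n * w, - k * w) d = d"
  proof (cases "w \<ge> 0")
    case True
    thus ?thesis using nat[of "nat w"] by simp
  next
    case False
    have "shift3 (m * w, - n * w, - k * w) (shift3 (m * int (nat (- w)), - n * int (nat (- w)), - k * int (nat (- w))) d) = d"
      using False by (simp add: shift.act_act) (simp add: zero_prod_def[symmetric])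
    thus ?thesis by (simp only: nat)
  qed
  have "shift3 (0, n * w, k * w) d = shift3 (0, n * w, k * w) (shift3 (m * w, - n * w, - k * w) d)"
    by (simp only: int)
  thus ?thesis by (simp add: shift.act_act)
qed

theorem theorem6p4:
  fixes d :: "'a::field_char_0 polyxyz"
    and lam :: nat and m :: nat and n k :: int
    and I :: nat and mm :: "nat \<Rightarrow> nat"
    and b :: "nat \<Rightarrow> nat \<Rightarrow> 'a polyxyz"
    and c :: "nat \<Rightarrow> 'a polyxy"
    and r :: "'a ratxyz"
  assumes lam_pos: "lam > 0"
    and d_irr: "irreducible d"
    and m_pos: "m > 0"
    and m_shift: "shx3 (int m) d = shy3 n (shz3 k d)"
    and m_min: "\<And>m' n' k'. 0 < m' \<Longrightarrow> m' < m \<Longrightarrow> shx3 (int m') d \<noteq> shy3 n' (shz3 k' d)"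
    and no_yz: "\<And>n1 k1. n1 > 0 \<Longrightarrow> shy3 n1 d \<noteq> shz3 k1 d"
    and b_degz: "\<And>i l. i \<in> {1..I} \<Longrightarrow> l \<in> {1..mm i} \<Longrightarrow> degz (b i l) < degz d"
    and c_irr: "\<And>i. i \<in> {1..I} \<Longrightarrow> irreducible (c i)"
    and c_distinct: "inj_on c {1..I}"
    and b_degy: "\<And>i l. i \<in> {1..I} \<Longrightarrow> l \<in> {1..mm i} \<Longrightarrow> degy3 (b i l) < degy2 (c i)"
    and c_shift: "\<And>i t. i \<in> {1..I} \<Longrightarrow> t > 0 \<Longrightarrow>
                     shx2 (t * int m) (c i) \<noteq> shy2 (t * n) (c i)"
    and r_def: "r = inverse (rat3 d ^ lam) *
                  (\<Sum>i\<in>{1..I}. \<Sum>l\<in>{1..mm i}. rat3 (b i l) / rat3 ([:c i:] ^ l))"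
  shows "has_telescoper r \<longleftrightarrow> r = 0"
proof
  assume r0: "r = 0"
  show "has_telescoper r" unfolding has_telescoper_def
    by (rule exI[of _ 0], rule exI[of _ "\<lambda>_. 1"]) (simp add: sig_eq_fract_act r0)
next
  assume "has_telescoper r"
  then obtain N and l :: "nat \<Rightarrow> 'a ratx" where l: "\<exists>i\<le>N. l i \<noteq> 0"
    and summable_N: "yz_summable (\<Sum>i\<le>N. embx (l i) * sigx (int i) r)"
    unfolding has_telescoper_def by blast
  define a where "a = (\<Sum>i\<in>{1..I}. \<Sum>l\<in>{1..mm i}. rat3 (b i l) / rat3 ([:c i:] ^ l))"
  have r_a: "r = inverse (rat3 d ^ lam) * a" by (simp add: r_def a_def)
  show "r = 0"
  proof (cases "degree d = 0")
    case True
    \<comment> \<open>No numerator can have degree in z below 0, so all inner sums are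
      empty.\<close>
    have "mm i = 0" if i: "i \<in> {1..I}" for i
    proof (rule ccontr)
      assume "mm i \<noteq> 0"
      hence "1 \<in> {1..mm i}" by auto
      from b_degz[OF i this] True show False by (simp add: degz_def)
    qed
    hence "a = 0" by (simp add: a_def)
    thus ?thesis by (simp add: r_a)
  next
    case False
    hence deg: "degree d > 0" by simp
    have d: "prime_elem d" using d_irr by (rule prime_elem_iff_irreducible[THEN iffD2])
    have m_shift': "shift3 (int m, 0, 0) d = shift3 (0, n, k) d"
      using m_shift by (simp add: shift3_def)
    have m_min': "shift3 (e, 0, 0) d \<noteq> shift3 (0, n', k') d" if "0 < e" "e < int m" for e n' k'
      using m_min[of "nat e" n' k'] that by (simp add: shift3_def)
    \<comment> \<open>If the shift moves y, it or its inverse has a positive y-component, which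
      \<open>no_yz\<close> excludes; a pure shift in z fixes only polynomials free of z.\<close>
    have free: "shift3 (0, n', k') d \<noteq> d" if nk: "(n', k') \<noteq> (0, 0)" for n' k'
    proof
      assume eq: "shift3 (0, n', k') d = d"
      have pos: False if "shift3 (0, n', k') d = d" "n' > 0" for n' k'
      proof -
        have "shift3 (0, n', 0) d = shift3 (0, 0, - k') (shift3 (0, n', k') d)"
          by (simp add: shift.act_act)
        hence "shift3 (0, n', 0) d = shift3 (0, 0, - k') d" by (simp only: that(1))
        thus False using no_yz[OF that(2), of "- k'"] by (simp add: shift3_def)
      qed
      consider "n' > 0" | "n' < 0" | "n' = 0" "k' \<noteq> 0" using nk by fastforce
      thus False
      proof cases
        case 1
        thus False using pos eq by blast
      next
        case 2
        have "shift3 (0, - n', - k') (shift3 (0, n', k') d) = d"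
          by (simp add: shift.act_act) (simp add: zero_prod_def[symmetric])
        hence "shift3 (0, - n', - k') d = d" by (simp only: eq)
        thus False using pos[of "- n'" "- k'"] 2 by simp
      next
        case 3
        hence "shz3 k' d = d" using eq by (simp add: shift3_def)
        thus False using shz3_eq_self_imp_degree_0[of k' d] 3(2) deg by simp
      qed
    qed

    \<comment> \<open>Only those \<open>c i\<close> that occur in the sum are kept: for them the
      degree bound at index 1 forces positive degree in y, whereas a \<open>c i\<close> with empty
      inner sum may lie in K[x].\<close>
    define C where "C = c ` {i \<in> {1..I}. 1 \<le> mm i}"
    have C_prime: "prime_elem p" if "p \<in> C" for p
      using that c_irr by (auto simp: C_def)
    have C_deg: "degree p > 0" if "p \<in> C" for p
      using that b_degy[of _ 1] by (fastforce simp: C_def degy2_def)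
    have C_nz: "0 \<notin> C" using C_deg by fastforce
    have a_y: "y_proper C a" unfolding a_def
    proof (intro y_proper_sum[OF C_nz])
      fix i j assume ij: "i \<in> {1..I}" "j \<in> {1..mm i}"
      hence "c i \<in> C" by (auto simp: C_def)
      thus "y_proper C (rat3 (b i j) / rat3 ([:c i:] ^ j))"
        using ij b_degy[OF ij] C_nz by (intro y_proper_divide_power) (auto simp: degy2_def)
    qed
    have a_z: "z_proper (degree d) a" unfolding a_def
    proof (intro z_proper_sum)
      fix i j assume ij: "i \<in> {1..I}" "j \<in> {1..mm i}"
      hence "c i \<in> C" by (auto simp: C_def)
      hence "c i ^ j \<noteq> 0" using C_nz by auto
      thus "z_proper (degree d) (rat3 (b i j) / rat3 ([:c i:] ^ j))"
        unfolding poly_const_pow using b_degz[OF ij]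
        by (intro z_proper_divide_const) (auto simp: degz_def)
    qed

    define i0 where "i0 = Max {i. i \<le> N \<and> l i \<noteq> 0}"
    have "i0 \<in> {i. i \<le> N \<and> l i \<noteq> 0}" unfolding i0_def using l by (intro Max_in) auto
    hence i0: "i0 \<le> N" "l i0 \<noteq> 0" by auto
    have l_zero: "l i = 0" if "i \<le> N" "i > i0" for i
    proof (rule ccontr)
      assume "l i \<noteq> 0"
      hence "i \<le> i0" unfolding i0_def using that by (intro Max_ge) auto
      thus False using that by simp
    qed
    have summable: "yz_summable (\<Sum>i\<le>i0. embx (l i) * shift.fract_act (int i, 0, 0) r)"
    proof -
      have "(\<Sum>i\<le>i0. embx (l i) * sigx (int i) r) = (\<Sum>i\<le>N. embx (l i) * sigx (int i) r)"
        using i0 l_zero by (intro sum.mono_neutral_left) auto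
      thus ?thesis using summable_N by (simp add: sig_eq_fract_act)
    qed

    define q where "q = shift3 (int i0, 0, 0) d"
    define g where "g = (\<lambda>t. (int m * t, - n * t, - k * t))"
    define h where "h = (int i0, 0::int, 0::int)"
    \<comment> \<open>The indices congruent to \<open>i0\<close> modulo \<open>m\<close> are
      \<open>i0 - m * t\<close>. Counting down from \<open>i0\<close> makes \<open>t = 0\<close> the
      term with the nonzero coefficient \<open>l i0\<close>.\<close>
    define S where "S = {t::int. t \<ge> 0 \<and> int m * t \<le> int i0}"
    define idx where "idx t = nat (int i0 - int m * t)" for t
    have fin_S: "finite S"
    proof (rule finite_subset)
      show "S \<subseteq> {0..int i0}"
      proof
        fix t assume "t \<in> S"
        hence "t \<ge> 0" "int m * t \<le> int i0" by (auto simp: S_def)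
        moreover have "1 * t \<le> int m * t" using m_pos \<open>t \<ge> 0\<close> by (intro mult_right_mono) auto
        ultimately show "t \<in> {0..int i0}" by simp
      qed
    qed simp
    have int_idx: "int (idx t) = int i0 - int m * t" if "t \<in> S" for t
      using that by (simp add: idx_def S_def)
    have inj_idx: "inj_on idx S"
    proof (rule inj_onI)
      fix s t assume st: "s \<in> S" "t \<in> S" "idx s = idx t"
      have "int i0 - int m * s = int i0 - int m * t"
        using int_idx[OF st(1)] int_idx[OF st(2)] st(3) by metis
      hence "int m * s = int m * t" by simp
      thus "s = t" using m_pos by simp
    qed
    have q_prime: "prime_elem q"
      unfolding q_def by (rule shift.prime_elem_act[THEN iffD2, OF d])
    have q_deg: "degree q = degree d" by (simp add: q_def)
    \<comment> \<open>The shift by \<open>g t\<close> fixes \<open>d\<close>, so all terms moved in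
      this way share the denominator \<open>q ^ lam\<close>.\<close>
    have d_g: "shift3 (h - g t) d = q" for t
    proof -
      have "shift3 (h - g t) d = shift3 (int i0, n * t, k * t) (shift3 (int m * (- t), 0, 0) d)"
        by (simp add: h_def g_def shift.act_act)
      also have "\<dots> = q" unfolding shift3_multiple[OF m_shift'] by (simp add: shift.act_act q_def)
      finally show ?thesis .
    qed
    have act_r: "shift.fract_act u r = inverse (rat3 (shift3 u d) ^ lam) * shift.fract_act u a" for u
      by (simp add: r_a shift.fract_act_mult shift.fract_act_inverse shift.fract_act_power fract_act_rat3)

    define X where "X = (\<Sum>t\<in>S. embx (l (idx t)) * shift.fract_act (h - g t) a)"
    define Y where "Y = (\<Sum>i\<in>{..i0} - idx ` S. embx (l i) * shift.fract_act (int i, 0, 0) r)"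
    have X_r: "inverse (rat3 q ^ lam) * X = (\<Sum>t\<in>S. embx (l (idx t)) * shift.fract_act (h - g t) r)"
      unfolding X_def act_r d_g by (simp add: sum_distrib_left mult.left_commute)
    have sum_XY: "yz_summable (inverse (rat3 q ^ lam) * X + Y)"
    proof -
      define Z where "Z = (\<Sum>t\<in>S. embx (l (idx t)) * shift.fract_act (int (idx t), 0, 0) r)"
      have "idx ` S \<subseteq> {..i0}"
      proof
        fix i assume "i \<in> idx ` S"
        then obtain t where t: "t \<in> S" "i = idx t" by blast
        have "0 \<le> int m * t" using t(1) by (simp add: S_def)
        thus "i \<in> {..i0}" using int_idx[OF t(1)] t(2) by simp
      qed
      hence "(\<Sum>i\<le>i0. embx (l i) * shift.fract_act (int i, 0, 0) r) =
          Y + (\<Sum>i\<in>idx ` S. embx (l i) * shift.fract_act (int i, 0, 0) r)"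
        unfolding Y_def by (rule sum.subset_diff) simp
      hence L: "(\<Sum>i\<le>i0. embx (l i) * shift.fract_act (int i, 0, 0) r) = Z + Y"
        by (simp add: Z_def sum.reindex[OF inj_idx])
      \<comment> \<open>The triple \<open>h - g t\<close> equals
        \<open>(idx t, n * t, k * t)\<close>, and coefficients from K(x) do not change under shifts
        in y and z; each difference is therefore summable.\<close>
      have "inverse (rat3 q ^ lam) * X - Z = (\<Sum>t\<in>S.
          shift.fract_act (0, n * t, k * t) (embx (l (idx t)) * shift.fract_act (int (idx t), 0, 0) r)
          - embx (l (idx t)) * shift.fract_act (int (idx t), 0, 0) r)"
        unfolding X_r Z_def sum_subtractf[symmetric]
        by (intro sum.cong)
          (auto simp: shift.fract_act_mult fract_act_embx shift.fract_act_fract_act int_idx h_def g_def)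
      hence "yz_summable (inverse (rat3 q ^ lam) * X - Z)"
        by (simp only: yz_summable_sum yz_summable_difference)
      from yz_summable_add[OF this summable] show ?thesis unfolding L by simp
    qed

    have q_orbit: "\<not> shift3 (0, n', k') q dvd q" if "(n', k') \<noteq> (0, 0)" for n' k'
    proof
      assume "shift3 (0, n', k') q dvd q"
      hence "shift3 (0, n', k') q = shift3 0 q" by (intro shift3_dvd_imp_eq[OF q_prime]) simp
      hence "shift3 (- int i0, 0, 0) (shift3 (0, n', k') q) = shift3 (- int i0, 0, 0) q" by simp
      hence "shift3 (0, n', k') d = d"
        by (simp add: q_def shift.act_act zero_prod_def[symmetric])
      thus False using free[OF that] by blast
    qed
    have other_orbit: "\<not> shift3 (0, n', k') q dvd shift3 (int i, 0, 0) d"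
      if i: "i \<in> {..i0} - idx ` S" for i n' k'
    proof
      assume "shift3 (0, n', k') q dvd shift3 (int i, 0, 0) d"
      hence "shift3 (int i0, n', k') d dvd shift3 (int i, 0, 0) d"
        by (simp add: q_def shift.act_act)
      hence eq: "shift3 (int i0, n', k') d = shift3 (int i, 0, 0) d" by (rule shift3_dvd_imp_eq[OF d])
      \<comment> \<open>Modulo multiples of \<open>(m, - n, - k)\<close>, the equation for
        \<open>d\<close> reduces to a shift by the remainder \<open>e\<close> in x. A nonzero
        \<open>e\<close> contradicts minimality of \<open>m\<close>, and \<open>e = 0\<close> makes
        \<open>i\<close> the index \<open>idx w\<close>.\<close>
      define w where "w = (int i0 - int i) div int m"
      define e where "e = (int i0 - int i) mod int m"
      have we: "int i0 - int i = int m * w + e" by (simp add: w_def e_def)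
      have "e \<ge> 0" "e < int m" using m_pos by (simp_all add: e_def)
      moreover have "e \<noteq> 0"
      proof
        assume "e = 0"
        have "w \<ge> 0" unfolding w_def using i m_pos by (simp add: pos_imp_zdiv_nonneg_iff)
        hence "w \<in> S" "idx w = i" using we \<open>e = 0\<close> i by (auto simp: S_def idx_def)
        thus False using i by blast
      qed
      moreover have "shift3 (e, 0, 0) d = shift3 (0, - n' - n * w, - k' - k * w) d"
      proof -
        have "shift3 (e, 0, 0) d = shift3 (- int i - int m * w, - n', - k') (shift3 (int i0, n', k') d)"
          using we by (simp add: shift.act_act algebra_simps)
        also have "\<dots> = shift3 (0, - n', - k') (shift3 (int m * (- w), 0, 0) d)"
          unfolding eq by (simp add: shift.act_act)
        also have "\<dots> = shift3 (0, - n' - n * w, - k' - k * w) d"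
          unfolding shift3_multiple[OF m_shift'] by (simp add: shift.act_act)
        finally show ?thesis .
      qed
      ultimately show False using m_min'[of e] by force
    qed
    have orbit_prime: "prime_elem (shift3 u q)" for u
      by (rule shift.prime_elem_act[THEN iffD2, OF q_prime])
    have orbit_deg: "degree (shift3 u q) > 0" for u using deg by (simp add: q_deg)
    have X_z: "z_proper (degree q) X" unfolding X_def q_deg
      by (intro z_proper_sum z_proper_embx_mult z_proper_fract_act a_z)
    have Y_reg: "regular_at (shift3 (0, n', k') q) Y" for n' k'
      unfolding Y_def act_r
    proof (intro regular_at_sum regular_at_mult orbit_prime)
      fix i assume i: "i \<in> {..i0} - idx ` S"
      show "regular_at (shift3 (0, n', k') q) (embx (l i))"
        using orbit_deg by (intro regular_at_embx) blast
      show "regular_at (shift3 (0, n', k') q) (inverse (rat3 (shift3 (int i, 0, 0) d) ^ lam))"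
        by (rule regular_at_inverse_rat3_power[OF orbit_prime other_orbit[OF i]])
      show "regular_at (shift3 (0, n', k') q) (shift.fract_act (int i, 0, 0) a)"
        by (rule z_proper_imp_regular_at[OF z_proper_fract_act[OF a_z] orbit_deg])
    qed
    \<comment> \<open>\<open>Y\<close> has no pole on the orbit and \<open>X\<close> none at primes
      involving z, so among the points of the orbit only \<open>q\<close> itself could be a
      pole.\<close>
    have "regular_at q (inverse (rat3 q ^ lam) * X + Y)"
    proof (rule yz_summable_imp_regular_at[OF q_prime _ _ sum_XY])
      show "degree q > 0" using deg by (simp add: q_deg)
      fix n' k' :: int assume nk: "(n', k') \<noteq> (0, 0)"
      show "shift3 (0, n', k') q \<noteq> q" using q_orbit[OF nk] by force
      show "regular_at (shift3 (0, n', k') q) (inverse (rat3 q ^ lam) * X + Y)"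
        by (intro regular_at_add regular_at_mult orbit_prime Y_reg
            regular_at_inverse_rat3_power q_orbit[OF nk] z_proper_imp_regular_at[OF X_z orbit_deg])
    qed
    moreover have "regular_at q Y" using Y_reg[of 0 0] by (simp add: zero_prod_def[symmetric])
    ultimately have "regular_at q (inverse (rat3 q ^ lam) * X + Y - Y)"
      using regular_at_diff[OF q_prime] by blast
    hence "regular_at q (inverse (rat3 q ^ lam) * X)" by simp
    hence "X = 0" by (rule z_proper_regular_at_imp_0[OF X_z q_prime lam_pos])
    have "a = 0"
    proof (rule shift_recurrence_imp_0[OF _ C_prime C_deg _ a_y fin_S])
      show "finite C" by (simp add: C_def)
      show "shx2 (t * int m) p \<noteq> shy2 (t * n) p" if "p \<in> C" "t > 0" for p t
        using that c_shift by (auto simp: C_def)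
      show "0 \<in> S" by (simp add: S_def)
      show "t \<ge> 0" if "t \<in> S" for t using that by (simp add: S_def)
      show "l (idx 0) \<noteq> 0" using i0(2) by (simp add: idx_def)
      show "(\<Sum>t\<in>S. embx (l (idx t)) * shift.fract_act (h - (int m * t, - n * t, - k * t)) a) = 0"
        using \<open>X = 0\<close> by (simp add: X_def g_def)
    qed
    thus ?thesis by (simp add: r_a)
  qed
qed

end
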